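(* Let $f:\mathbb{R}^d\to\{1,\dots,c\}$ be a (measurable) base classifier, $1\le k\le c-1$, $\sigma>0$, $\mathbf{x}\in\mathbb{R}^d$, $l\in\{1,\dots,c\}$, $n\ge1$ an integer, $\mu>0$, $\alpha\in(0,1)$. Run the randomized algorithm CERTIFY (described in the context) on input $(f,k,\sigma,\mathbf{x},l,n,\mu,\alpha)$, using either BINOCP or SIMUEM (fixed in advance) to compute the probability bounds. Then, with probability at least $1-\alpha$ over the randomness in CERTIFY, the following holds: if CERTIFY returns a radius $\underline{R_l}$ (i.e., does not ABSTAIN), then $l\in g_k(\mathbf{x}+\delta)$ for all $\delta\in\mathbb{R}^d$ with $\|\delta\|_2<\underline{R_l}$.
   Context: The smoothed classifier $g_k(\mathbf{z})$ returns the set of the $k$ labels $i\in\{1,\dots,c\}$ with the largest probabilities $\Pr(f(\mathbf{z}+\epsilon)=i)$, $\epsilon\sim\mathcal{N}(0,\sigma^2I)$ (ties broken arbitrarily). $\Phi$ is the standard Gaussian CDF on $\mathbb{R}$ and $\Phi^{-1}$ its inverse. $B(\beta;u,v)$ denotes the $\beta$-th quantile of the Beta distribution with shape parameters $u,v$, with the usual Clopper–Pearson conventions $B(\beta;0,v)=0$ and $B(\beta;u,0)=1$. Algorithm CERTIFY: 1. Draw $\epsilon_1,\dots,\epsilon_n$ i.i.d. from $\mathcal{N}(0,\sigma^2I)$ and set $n_i=\sum_{j=1}^n\mathbb{I}(f(\mathbf{x}+\epsilon_j)=i)$ for each label $i$. 2. Compute $\underline{p_l}$ and $\overline{p}_i$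 ($i\ne l$) by one of two methods. BINOCP: $\underline{p_l}=B(\alpha;n_l,n-n_l+1)$ and $\overline{p}_i=1-\underline{p_l}$ for all $i\neq l$. SIMUEM: $\underline{p_l}=B(\frac{\alpha}{c};n_l,n-n_l+1)$ and $\overline{p}_i=B(1-\frac{\alpha}{c};n_i+1,n-n_i)$ for all $i\neq l$. 3. Let $\overline{p}_{b_k}\ge\cdots\ge\overline{p}_{b_1}$ be the $k$ largest among $\{\overline{p}_i:i\ne l\}$ (ties broken arbitrarily). For each $t=1,\dots,k$ set $\overline{p}_{S_t}=\min\big(\sum_{j=1}^t\overline{p}_{b_j},\,1-\underline{p_l}\big)$, and compute by binary search a number $\underline{R_l}^t$ with $\underline{R_l}^t\le R_l^t\le\underline{R_l}^t+\mu$, where $R_l^t$ is the unique real solution of $\Phi\big(\Phi^{-1}(\underline{p_l})-\frac{R_l^t}{\sigma}\big)-\frac{1}{t}\Phi\big(\Phi^{-1}(\overline{p}_{S_t})+\frac{R_l^t}{\sigma}\big)=0$. (If $\underline{p_l}=0$ there is no such solution, and $\underline{R_l}^t$ is taken to be $\le 0$.) 4. Let $\underline{R_l}=\max\big(0,\max_{1\le t\le k}\underline{R_l}^t\big)$. If $\underline{R_l}>0$ return $\underline{R_l}$; otherwise return ABSTAIN. *)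

theory Defs
  imports "HOL-Probability.Probability"
begin

definition isotropic_gaussian :: "real \<Rightarrow> (real ^ 'd) measure" where
  "isotropic_gaussian \<sigma> =
     density lborel (\<lambda>z. ennreal (\<Prod>i\<in>UNIV. normal_density 0 \<sigma> (z $ i)))"

definition std_normal_cdf :: "real \<Rightarrow> real" where
  "std_normal_cdf = cdf std_normal_distribution"

definition beta_distribution :: "real \<Rightarrow> real \<Rightarrow> real measure" where
  "beta_distribution u v =
     density lborel (\<lambda>y. ennreal (indicator {0<..<1} y *
       (y powr (u - 1) * (1 - y) powr (v - 1) / Beta u v)))"

definition quantile :: "real measure \<Rightarrow> real \<Rightarrow> real" where
  "quantile M \<beta> = Inf {y. \<beta> \<le> cdf M y}"

text \<open>The zero cases are the Clopper--Pearson conventions.\<close>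

definition beta_quantile :: "real \<Rightarrow> real \<Rightarrow> real \<Rightarrow> real" where
  "beta_quantile \<beta> u v =
     (if u = 0 then 0 else if v = 0 then 1 else quantile (beta_distribution u v) \<beta>)"

definition label_prob :: "(real ^ 'd \<Rightarrow> nat) \<Rightarrow> real \<Rightarrow> real ^ 'd \<Rightarrow> nat \<Rightarrow> real" where
  "label_prob f \<sigma> z i = measure (isotropic_gaussian \<sigma>) {e. f (z + e) = i}"

text \<open>Ties are broken arbitrarily, so being the smoothed classifier is a property of \<open>g\<close>
  rather than a definition of it.\<close>

definition smoothed_classifier ::
    "(real ^ 'd \<Rightarrow> nat) \<Rightarrow> nat \<Rightarrow> nat \<Rightarrow> real \<Rightarrow> (real ^ 'd \<Rightarrow> nat set) \<Rightarrow> bool" where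
  "smoothed_classifier f c k \<sigma> g \<longleftrightarrow>
     (\<forall>z. g z \<subseteq> {1..c} \<and> card (g z) = k \<and>
        (\<forall>i\<in>g z. \<forall>j\<in>{1..c} - g z. label_prob f \<sigma> z j \<le> label_prob f \<sigma> z i))"

datatype bound_method = BINOCP | SIMUEM

definition label_count ::
    "(real ^ 'd \<Rightarrow> nat) \<Rightarrow> real ^ 'd \<Rightarrow> nat \<Rightarrow> (nat \<Rightarrow> real ^ 'd) \<Rightarrow> nat \<Rightarrow> nat" where
  "label_count f x n e i = (\<Sum>j=1..n. of_bool (f (x + e j) = i))"

text \<open>In the next two definitions \<open>N i\<close> is the number of the \<open>n\<close> samples that received label \<open>i\<close>.\<close>

fun lower_bound :: "bound_method \<Rightarrow> real \<Rightarrow> nat \<Rightarrow> nat \<Rightarrow> (nat \<Rightarrow> nat) \<Rightarrow> nat \<Rightarrow> real" where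
  "lower_bound BINOCP \<alpha> c n N l = beta_quantile \<alpha> (real (N l)) (real n - real (N l) + 1)"
| "lower_bound SIMUEM \<alpha> c n N l =
     beta_quantile (\<alpha> / real c) (real (N l)) (real n - real (N l) + 1)"

fun upper_bound :: "bound_method \<Rightarrow> real \<Rightarrow> nat \<Rightarrow> nat \<Rightarrow> (nat \<Rightarrow> nat) \<Rightarrow> nat \<Rightarrow> nat \<Rightarrow> real" where
  "upper_bound BINOCP \<alpha> c n N l i = 1 - lower_bound BINOCP \<alpha> c n N l"
| "upper_bound SIMUEM \<alpha> c n N l i =
     beta_quantile (1 - \<alpha> / real c) (real (N i) + 1) (real n - real (N i))"

text \<open>\<open>b 1, \<dots>, b k\<close> are \<open>k\<close> labels other than \<open>l\<close> with the largest values \<open>q\<close>, listed in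
  ascending order.\<close>

definition top_labels ::
    "(nat \<Rightarrow> real) \<Rightarrow> nat \<Rightarrow> nat \<Rightarrow> nat \<Rightarrow> (nat \<Rightarrow> nat) \<Rightarrow> bool" where
  "top_labels q c k l b \<longleftrightarrow>
     inj_on b {1..k} \<and> b ` {1..k} \<subseteq> {1..c} - {l} \<and>
     (\<forall>s\<in>{1..k}. \<forall>t\<in>{1..k}. s \<le> t \<longrightarrow> q (b s) \<le> q (b t)) \<and>
     (\<forall>i\<in>{1..c} - {l} - b ` {1..k}. \<forall>t\<in>{1..k}. q i \<le> q (b t))"

definition sum_bound :: "real \<Rightarrow> (nat \<Rightarrow> real) \<Rightarrow> (nat \<Rightarrow> nat) \<Rightarrow> nat \<Rightarrow> real" where
  "sum_bound p q b t = min (\<Sum>j=1..t. q (b j)) (1 - p)"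

definition exact_radius :: "real \<Rightarrow> nat \<Rightarrow> real \<Rightarrow> real \<Rightarrow> real" where
  "exact_radius \<sigma> t p s =
     (THE r. std_normal_cdf (inv std_normal_cdf p - r / \<sigma>)
             - 1 / real t * std_normal_cdf (inv std_normal_cdf s + r / \<sigma>) = 0)"

text \<open>\<open>certify f c k \<sigma> x l n \<mu> \<alpha> m e out\<close>: on the noise samples \<open>e 1, \<dots>, e n\<close> the algorithm may
  return \<open>out\<close>, where \<open>None\<close> stands for abstaining. It is a relation because both the
  tie-breaking (\<open>b\<close>) and the result of the binary search (\<open>R\<close>) are only constrained,
  not determined.\<close>

definition certify ::
    "(real ^ 'd \<Rightarrow> nat) \<Rightarrow> nat \<Rightarrow> nat \<Rightarrow> real \<Rightarrow> real ^ 'd \<Rightarrow> nat \<Rightarrow> nat \<Rightarrow> real \<Rightarrow> real \<Rightarrow>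
     bound_method \<Rightarrow> (nat \<Rightarrow> real ^ 'd) \<Rightarrow> real option \<Rightarrow> bool" where
  "certify f c k \<sigma> x l n \<mu> \<alpha> m e out \<longleftrightarrow>
     (let N = label_count f x n e;
          p = lower_bound m \<alpha> c n N l;
          q = upper_bound m \<alpha> c n N l
      in \<exists>b R.
           top_labels q c k l b \<and>
           (\<forall>t\<in>{1..k}.
              if p = 0 then R t \<le> 0
              else R t \<le> exact_radius \<sigma> t p (sum_bound p q b t) \<and>
                   exact_radius \<sigma> t p (sum_bound p q b t) \<le> R t + \<mu>) \<and>
           (let r = max 0 (Max (R ` {1..k}))
            in out = (if r > 0 then Some r else None)))"

end

theory Submission
  imports Defs "HOL-Real_Asymp.Real_Asymp"
begin

text \<open>The label counts are binomial, and the Beta distribution function with integer parameters is a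
  binomial tail; hence each Clopper--Pearson bound fails with probability at most its nominal
  level, and a union bound over the (one or \<open>c\<close>) bounds used leaves probability at least
  \<open>1 - \<alpha>\<close> that all of them hold.

  On that event the returned radius is correct. If \<open>l\<close> is not among the top \<open>k\<close> labels
  \<open>G = g (x + \<delta>)\<close>, then for each \<open>t \<le> k\<close> some \<open>t\<close>-subset of \<open>G\<close> has upper bounds summing
  to at most those of \<open>b 1, \<dots>, b t\<close>, and its probability at \<open>x + \<delta>\<close> is at least \<open>t\<close> times that
  of \<open>l\<close>. The Neyman--Pearson lemma for shifted Gaussians bounds the probability of the subset from
  above and that of \<open>l\<close> from below by the two terms of the equation defining the radius, and monotonicity in the
  radius gives \<open>exact_radius \<le> norm \<delta>\<close>.\<close>

subsection \<open>The normal distribution function\<close>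

text \<open>The density vanishes nowhere, so a null interval would be a Lebesgue null set. This
  yields strictness of the monotonicity below.\<close>

lemma std_normal_interval_pos:
  assumes "a < (b::real)"
  shows "measure std_normal_distribution {a<..b} > 0"
proof -
  interpret real_distribution std_normal_distribution by (rule real_dist_normal_dist)
  have "emeasure std_normal_distribution {a<..b} \<noteq> 0"
  proof
    assume "emeasure std_normal_distribution {a<..b} = 0"
    hence "(\<integral>\<^sup>+x. ennreal (std_normal_density x) * indicator {a<..b} x \<partial>lborel) = 0"
      by (simp add: emeasure_density)
    hence "AE x in lborel. ennreal (std_normal_density x) * indicator {a<..b} x = 0"
      by (subst (asm) nn_integral_0_iff_AE) auto
    hence "AE x in lborel. x \<notin> {a<..b}"
    proof (rule eventually_mono)
      fix x assume "ennreal (std_normal_density x) * indicator {a<..b} x = 0"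
      thus "x \<notin> {a<..b}"
        using normal_density_pos[of 1 0 x] by (auto simp: indicator_def ennreal_eq_0_iff)
    qed
    hence "emeasure lborel {a<..b} = 0"
      by (subst (asm) AE_iff_measurable[of "{a<..b}"]) auto
    with assms show False by simp
  qed
  thus ?thesis by (simp add: emeasure_eq_measure zero_less_measure_iff)
qed

lemma std_normal_measure_singleton: "measure std_normal_distribution {x} = 0"
proof -
  have "emeasure std_normal_distribution {x} = 0"
    by (subst emeasure_density) (auto intro!: nn_integral_null_set simp: null_sets_def)
  thus ?thesis by (simp add: measure_def)
qed

lemma strict_mono_std_normal_cdf: "strict_mono std_normal_cdf"
proof (rule strict_monoI)
  interpret real_distribution std_normal_distribution by (rule real_dist_normal_dist)
  fix x y :: real assume "x < y"
  thus "std_normal_cdf x < std_normal_cdf y"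
    using cdf_diff_eq[of x y] std_normal_interval_pos[of x y] by (simp add: std_normal_cdf_def)
qed

lemma std_normal_cdf_less_iff [simp]: "std_normal_cdf x < std_normal_cdf y \<longleftrightarrow> x < y"
  using strict_mono_std_normal_cdf by (rule strict_mono_less)

lemma std_normal_cdf_at_top: "(std_normal_cdf \<longlongrightarrow> 1) at_top"
proof -
  interpret real_distribution std_normal_distribution by (rule real_dist_normal_dist)
  show ?thesis unfolding std_normal_cdf_def by (rule cdf_lim_at_top_prob)
qed

lemma std_normal_cdf_at_bot: "(std_normal_cdf \<longlongrightarrow> 0) at_bot"
proof -
  interpret real_distribution std_normal_distribution by (rule real_dist_normal_dist)
  show ?thesis unfolding std_normal_cdf_def by (rule cdf_lim_at_bot)
qed

lemma isCont_std_normal_cdf: "isCont std_normal_cdf x"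
proof -
  interpret real_distribution std_normal_distribution by (rule real_dist_normal_dist)
  show ?thesis unfolding std_normal_cdf_def isCont_cdf by (rule std_normal_measure_singleton)
qed

text \<open>The standard normal law is invariant under reflection. The half-lines
  \<open>{x..}\<close> and \<open>{..x}\<close> overlap only in the null point
  \<open>x\<close>.\<close>

lemma std_normal_cdf_uminus: "std_normal_cdf (- x) = 1 - std_normal_cdf x"
proof -
  interpret real_distribution std_normal_distribution by (rule real_dist_normal_dist)
  have "distributed std_normal_distribution lborel (\<lambda>x. x) (normal_density 0 1)"
    by (auto simp: distributed_def distr_id2)
  from normal_density_affine[OF this, of "-1" 0]
  have "distributed std_normal_distribution lborel (\<lambda>x. - x) (normal_density 0 1)" by simp
  hence eq: "distr std_normal_distribution lborel (\<lambda>x. - x) = std_normal_distribution"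
    by (auto simp: distributed_def)
  have "std_normal_cdf (- x) = measure (distr std_normal_distribution lborel (\<lambda>x. - x)) {..-x}"
    by (simp add: std_normal_cdf_def cdf_def eq)
  also have "\<dots> = measure std_normal_distribution {x..}"
    by (subst measure_distr) (auto intro!: arg_cong[of _ _ "measure std_normal_distribution"])
  also have "{x..} = {x} \<union> (space std_normal_distribution - {..x})" by auto
  also have "measure std_normal_distribution \<dots> =
      measure std_normal_distribution {x} + prob (space std_normal_distribution - {..x})"
    by (rule finite_measure_Union) auto
  also have "\<dots> = 1 - std_normal_cdf x"
    by (subst prob_compl) (auto simp: std_normal_measure_singleton std_normal_cdf_def cdf_def)
  finally show ?thesis .
qed

text \<open>\<open>inv std_normal_cdf\<close> is a genuine inverse only on the range of
  \<open>std_normal_cdf\<close>. The limits 0 and 1 together with the intermediate value theorem put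
  every \<open>p\<close> strictly between 0 and 1 into that range.\<close>

lemma std_normal_cdf_surj:
  assumes "0 < p" "p < 1"
  shows "p \<in> range std_normal_cdf"
proof -
  have "eventually (\<lambda>x. std_normal_cdf x < p) at_bot"
    using std_normal_cdf_at_bot assms by (simp add: order_tendsto_iff)
  then obtain a where a: "std_normal_cdf a < p" by (auto simp: eventually_at_bot_linorder)
  have "eventually (\<lambda>x. std_normal_cdf x > p) at_top"
    using std_normal_cdf_at_top assms by (simp add: order_tendsto_iff)
  then obtain b where b: "std_normal_cdf b > p" by (auto simp: eventually_at_top_linorder)
  have "a < b" using a b by (metis less_trans std_normal_cdf_less_iff)
  have "\<exists>x. a \<le> x \<and> x \<le> b \<and> std_normal_cdf x = p"
    using a b \<open>a < b\<close> by (intro IVT) (auto simp: isCont_std_normal_cdf)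
  thus ?thesis by auto
qed

lemma std_normal_cdf_inv:
  "0 < p \<Longrightarrow> p < 1 \<Longrightarrow> std_normal_cdf (inv std_normal_cdf p) = p"
  by (rule f_inv_into_f[OF std_normal_cdf_surj])

lemma std_normal_cdf_inv_compl:
  assumes "0 < p" "p < 1"
  shows "inv std_normal_cdf (1 - p) = - inv std_normal_cdf p"
proof -
  have "std_normal_cdf (- inv std_normal_cdf p) = 1 - p"
    using std_normal_cdf_inv[OF assms] by (simp add: std_normal_cdf_uminus)
  thus ?thesis
    using strict_mono_std_normal_cdf by (metis inv_f_f strict_mono_imp_inj_on)
qed

section \<open>The equation defining the radius\<close>

lemma filterlim_affine_at_top_at_bot:
  fixes a \<sigma> :: real
  assumes "\<sigma> > 0"
  shows "filterlim (\<lambda>x. a + x / \<sigma>) at_top at_top"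
    and "filterlim (\<lambda>x. a + x / \<sigma>) at_bot at_bot"
    and "filterlim (\<lambda>x. a - x / \<sigma>) at_bot at_top"
    and "filterlim (\<lambda>x. a - x / \<sigma>) at_top at_bot"
  using assms by (real_asymp, real_asymp, real_asymp, real_asymp)

text \<open>The left-hand side is continuous and strictly decreasing in the radius, with limit 1 at
  minus infinity and \<open>- 1 / t\<close> at plus infinity. Hence it has exactly one root, the
  \<open>THE\<close> in \<open>exact_radius\<close> denotes it, and everything to its left is
  positive.\<close>

lemma radius_equation_pos:
  assumes "\<sigma> > 0" "0 < p" "p < 1" "0 < s" "s < 1" "t \<ge> 1" "r < exact_radius \<sigma> t p s"
  shows "std_normal_cdf (inv std_normal_cdf p - r / \<sigma>)
             - 1 / real t * std_normal_cdf (inv std_normal_cdf s + r / \<sigma>) > 0"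
proof -
  define h where "h r = std_normal_cdf (inv std_normal_cdf p - r / \<sigma>)
             - 1 / real t * std_normal_cdf (inv std_normal_cdf s + r / \<sigma>)" for r
  have anti: "h y < h x" if "x < y" for x y
  proof -
    have "std_normal_cdf (inv std_normal_cdf p - y / \<sigma>) < std_normal_cdf (inv std_normal_cdf p - x / \<sigma>)"
      using that assms by (simp add: divide_strict_right_mono)
    moreover have "1 / real t * std_normal_cdf (inv std_normal_cdf s + x / \<sigma>) <
        1 / real t * std_normal_cdf (inv std_normal_cdf s + y / \<sigma>)"
      using that assms by (intro mult_strict_left_mono) (auto simp: divide_strict_right_mono)
    ultimately show ?thesis unfolding h_def by linarith
  qed
  have cont: "isCont h x" for x
    unfolding h_def
    by (intro continuous_intros isCont_o2[OF _ isCont_std_normal_cdf]) (use assms in auto)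
  have lim_bot: "(h \<longlongrightarrow> 1 - 1 / real t * 0) at_bot"
    unfolding h_def
  proof (intro tendsto_intros)
    have "filterlim (\<lambda>x. inv std_normal_cdf p - x / \<sigma>) at_top at_bot"
      using assms(1) by (rule filterlim_affine_at_top_at_bot)
    thus "((\<lambda>x. std_normal_cdf (inv std_normal_cdf p - x / \<sigma>)) \<longlongrightarrow> 1) at_bot"
      by (rule filterlim_compose[OF std_normal_cdf_at_top])
    have "filterlim (\<lambda>x. inv std_normal_cdf s + x / \<sigma>) at_bot at_bot"
      using assms(1) by (rule filterlim_affine_at_top_at_bot)
    thus "((\<lambda>x. std_normal_cdf (inv std_normal_cdf s + x / \<sigma>)) \<longlongrightarrow> 0) at_bot"
      by (rule filterlim_compose[OF std_normal_cdf_at_bot])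
  qed
  have lim_top: "(h \<longlongrightarrow> 0 - 1 / real t * 1) at_top"
    unfolding h_def
  proof (intro tendsto_intros)
    have "filterlim (\<lambda>x. inv std_normal_cdf p - x / \<sigma>) at_bot at_top"
      using assms(1) by (rule filterlim_affine_at_top_at_bot)
    thus "((\<lambda>x. std_normal_cdf (inv std_normal_cdf p - x / \<sigma>)) \<longlongrightarrow> 0) at_top"
      by (rule filterlim_compose[OF std_normal_cdf_at_bot])
    have "filterlim (\<lambda>x. inv std_normal_cdf s + x / \<sigma>) at_top at_top"
      using assms(1) by (rule filterlim_affine_at_top_at_bot)
    thus "((\<lambda>x. std_normal_cdf (inv std_normal_cdf s + x / \<sigma>)) \<longlongrightarrow> 1) at_top"
      by (rule filterlim_compose[OF std_normal_cdf_at_top])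
  qed
  have "eventually (\<lambda>x. h x > 0) at_bot"
    by (rule order_tendstoD(1)[OF lim_bot]) auto
  then obtain a where a: "h a > 0" by (auto simp: eventually_at_bot_linorder)
  have "eventually (\<lambda>x. h x < 0) at_top"
    by (rule order_tendstoD(2)[OF lim_top]) (use assms in auto)
  then obtain b where b: "h b < 0" by (auto simp: eventually_at_top_linorder)
  have "a < b" using a b anti[of b a] by (cases a b rule: linorder_cases) auto
  then obtain z where z: "h z = 0"
    using IVT2[of h b 0 a] a b cont by auto
  have "exact_radius \<sigma> t p s = z"
    unfolding exact_radius_def h_def[symmetric]
    using z anti by (intro the_equality) (metis linorder_cases less_irrefl)+
  thus ?thesis using anti[of r z] z assms unfolding h_def by simp
qed

subsection \<open>Gaussian mass under translation\<close>

definition gaussian_density :: "real \<Rightarrow> real ^ 'd \<Rightarrow> real" where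
  "gaussian_density \<sigma> z = (\<Prod>i\<in>UNIV. normal_density 0 \<sigma> (z $ i))"

lemma gaussian_density_nonneg: "gaussian_density \<sigma> z \<ge> 0"
  unfolding gaussian_density_def by (intro prod_nonneg) auto

lemma borel_measurable_gaussian_density [measurable]:
  "gaussian_density \<sigma> \<in> borel_measurable (borel :: (real ^ 'd) measure)"
  unfolding gaussian_density_def [abs_def] by measurable

lemma isotropic_gaussian_density:
  "isotropic_gaussian \<sigma> = density lborel (\<lambda>z. ennreal (gaussian_density \<sigma> z))"
  unfolding isotropic_gaussian_def gaussian_density_def ..

lemma sets_isotropic_gaussian [simp, measurable_cong]: "sets (isotropic_gaussian \<sigma>) = sets borel"
  by (simp add: isotropic_gaussian_def)

lemma space_isotropic_gaussian [simp]: "space (isotropic_gaussian \<sigma>) = UNIV"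
  by (simp add: isotropic_gaussian_def)

section \<open>Product structure of the isotropic Gaussian\<close>

lemma prod_Basis_vec:
  "(\<Prod>b\<in>(Basis :: (real ^ 'd) set). h b) = (\<Prod>i\<in>UNIV. h (axis i 1))"
proof -
  have "(Basis :: (real ^ 'd) set) = range (\<lambda>i. axis i 1)" by (auto simp: Basis_vec_def)
  hence "(\<Prod>b\<in>(Basis :: (real ^ 'd) set). h b) = (\<Prod>b\<in>range (\<lambda>i. axis i 1). h b)" by (rule arg_cong)
  also have "\<dots> = (\<Prod>i\<in>UNIV. h (axis i 1))"
    by (subst prod.reindex) (auto simp: inj_on_def axis_eq_axis)
  finally show ?thesis .
qed

text \<open>This is the product formula over \<open>Basis\<close>, with \<open>axis_index\<close>
  turning each unit vector back into its coordinate.\<close>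

lemma nn_integral_lborel_vec_prod:
  fixes h :: "'d::finite \<Rightarrow> real \<Rightarrow> ennreal"
  assumes [measurable]: "\<And>i. h i \<in> borel_measurable borel"
  shows "(\<integral>\<^sup>+z. (\<Prod>i\<in>UNIV. h i (z $ i)) \<partial>lborel) = (\<Prod>i\<in>UNIV. \<integral>\<^sup>+y. h i y \<partial>lborel)"
proof -
  have "(\<integral>\<^sup>+z. (\<Prod>b\<in>(Basis :: (real ^ 'd) set). h (axis_index b) (z \<bullet> b)) \<partial>lborel) =
      (\<Prod>b\<in>(Basis :: (real ^ 'd) set). \<integral>\<^sup>+y. h (axis_index b) y \<partial>lborel)"
    by (rule nn_integral_lborel_prod) auto
  thus ?thesis by (simp add: prod_Basis_vec inner_axis)
qed

text \<open>Both the density and the indicator of a box factor over the coordinates.\<close>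

lemma emeasure_isotropic_gaussian_box:
  assumes "\<And>i. A i \<in> sets borel"
  shows "emeasure (isotropic_gaussian \<sigma>) {z :: real ^ 'd. \<forall>i. z $ i \<in> A i} =
     (\<Prod>i\<in>UNIV. emeasure (density lborel (\<lambda>y. ennreal (normal_density 0 \<sigma> y))) (A i))"
proof -
  note assms [measurable]
  have m [measurable]: "{z :: real ^ 'd. \<forall>i. z $ i \<in> A i} \<in> sets borel" by measurable
  have "emeasure (isotropic_gaussian \<sigma>) {z :: real ^ 'd. \<forall>i. z $ i \<in> A i} =
     (\<integral>\<^sup>+z. (\<Prod>i\<in>UNIV. ennreal (normal_density 0 \<sigma> (z $ i)) * indicator (A i) (z $ i)) \<partial>lborel)"
    unfolding isotropic_gaussian_def
    by (subst emeasure_density)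
       (auto intro!: nn_integral_cong simp: prod_ennreal[symmetric] prod.distrib indicator_def
          prod_zero_iff)
  also have "\<dots> = (\<Prod>i\<in>UNIV. \<integral>\<^sup>+y. ennreal (normal_density 0 \<sigma> y) * indicator (A i) y \<partial>lborel)"
    by (rule nn_integral_lborel_vec_prod) measurable
  also have "\<dots> = (\<Prod>i\<in>UNIV. emeasure (density lborel (\<lambda>y. ennreal (normal_density 0 \<sigma> y))) (A i))"
    by (intro prod.cong refl, subst emeasure_density) auto
  finally show ?thesis .
qed

lemma prob_space_isotropic_gaussian:
  assumes "\<sigma> > 0"
  shows "prob_space (isotropic_gaussian \<sigma> :: (real ^ 'd) measure)"
proof
  interpret prob_space "density lborel (\<lambda>y. ennreal (normal_density 0 \<sigma> y))"
    by (rule prob_space_normal_density[OF assms])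
  show "emeasure (isotropic_gaussian \<sigma> :: (real ^ 'd) measure) (space (isotropic_gaussian \<sigma>)) = 1"
    using emeasure_isotropic_gaussian_box[of "\<lambda>_. UNIV" \<sigma>] emeasure_space_1 by simp
qed

text \<open>A Borel condition on one coordinate is a box whose other sides are the whole line, each
  of mass 1.\<close>

lemma distributed_isotropic_gaussian_nth:
  assumes "\<sigma> > 0"
  shows "distributed (isotropic_gaussian \<sigma> :: (real ^ 'd) measure) lborel (\<lambda>z. z $ i) (normal_density 0 \<sigma>)"
  unfolding distributed_def
proof safe
  interpret N: prob_space "density lborel (\<lambda>y. ennreal (normal_density 0 \<sigma> y))"
    by (rule prob_space_normal_density[OF assms])
  show "distr (isotropic_gaussian \<sigma> :: (real ^ 'd) measure) lborel (\<lambda>z. z $ i) =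
      density lborel (\<lambda>y. ennreal (normal_density 0 \<sigma> y))"
  proof (rule measure_eqI)
    fix A assume "A \<in> sets (distr (isotropic_gaussian \<sigma> :: (real ^ 'd) measure) lborel (\<lambda>z. z $ i))"
    hence A [measurable]: "A \<in> sets borel" by simp
    have "emeasure (distr (isotropic_gaussian \<sigma> :: (real ^ 'd) measure) lborel (\<lambda>z. z $ i)) A =
        emeasure (isotropic_gaussian \<sigma>) {z :: real ^ 'd. \<forall>j. z $ j \<in> (if j = i then A else UNIV)}"
      by (subst emeasure_distr) (auto intro!: arg_cong[of _ _ "emeasure (isotropic_gaussian \<sigma>)"])
    also have "\<dots> = (\<Prod>j\<in>UNIV. if j = i then emeasure (density lborel (\<lambda>y. ennreal (normal_density 0 \<sigma> y))) A else 1)"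
      by (subst emeasure_isotropic_gaussian_box, simp, intro prod.cong refl)
         (use N.emeasure_space_1 in auto)
    also have "\<dots> = emeasure (density lborel (\<lambda>y. ennreal (normal_density 0 \<sigma> y))) A" by simp
    finally show "emeasure (distr (isotropic_gaussian \<sigma> :: (real ^ 'd) measure) lborel (\<lambda>z. z $ i)) A = \<dots>" .
  qed simp
qed measurable

text \<open>The box formula is the product rule for arbitrary Borel sides, so the Borel sets
  themselves serve as the intersection-stable generator.\<close>

lemma indep_vars_isotropic_gaussian:
  assumes "\<sigma> > 0"
  shows "prob_space.indep_vars (isotropic_gaussian \<sigma> :: (real ^ 'd) measure) (\<lambda>_. borel) (\<lambda>i z. z $ i) UNIV"
proof -
  interpret prob_space "isotropic_gaussian \<sigma> :: (real ^ 'd) measure"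
    by (rule prob_space_isotropic_gaussian[OF assms])
  interpret N: prob_space "density lborel (\<lambda>y. ennreal (normal_density 0 \<sigma> y))"
    by (rule prob_space_normal_density[OF assms])
  have 1: "prob ((\<lambda>z. z $ i) -` A \<inter> space (isotropic_gaussian \<sigma>)) =
      measure (density lborel (\<lambda>y. ennreal (normal_density 0 \<sigma> y))) A" if "A \<in> sets borel" for A i
  proof -
    have "measure (density lborel (\<lambda>y. ennreal (normal_density 0 \<sigma> y))) A =
        measure (distr (isotropic_gaussian \<sigma> :: (real ^ 'd) measure) lborel (\<lambda>z. z $ i)) A"
      using distributed_isotropic_gaussian_nth[OF assms, of i] by (simp add: distributed_def)
    thus ?thesis using that by (simp add: measure_distr)
  qed
  have "prob ((\<Inter>j\<in>UNIV. (\<lambda>z. z $ j) -` A j) \<inter> space (isotropic_gaussian \<sigma>)) =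
        (\<Prod>j\<in>UNIV. prob ((\<lambda>z. z $ j) -` A j \<inter> space (isotropic_gaussian \<sigma>)))"
      if "\<And>i. A i \<in> sets borel" for A :: "'d \<Rightarrow> real set"
  proof -
    have "(\<Inter>j\<in>UNIV. (\<lambda>z. z $ j) -` A j) \<inter> space (isotropic_gaussian \<sigma> :: (real ^ 'd) measure) =
        {z. \<forall>i. z $ i \<in> A i}" by auto
    thus ?thesis
      using emeasure_isotropic_gaussian_box[of A \<sigma>] that 1
      by (simp add: emeasure_eq_measure N.emeasure_eq_measure prod_ennreal prod_nonneg)
  qed
  thus ?thesis
    by (subst indep_vars_finite[where E = "\<lambda>_. sets borel"])
       (auto simp: sets.sigma_sets_eq[of borel, simplified] Int_stable_def)
qed

text \<open>The inner product with \<open>d\<close> is a sum of independent centred normals, hence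
  normal with standard deviation \<open>\<sigma> * norm d\<close>.\<close>

lemma isotropic_gaussian_halfspace:
  fixes d :: "real ^ 'd"
  assumes "\<sigma> > 0" "d \<noteq> 0"
  shows "measure (isotropic_gaussian \<sigma>) {z. z \<bullet> d \<le> \<tau>} = std_normal_cdf (\<tau> / (\<sigma> * norm d))"
proof -
  interpret prob_space "isotropic_gaussian \<sigma> :: (real ^ 'd) measure"
    by (rule prob_space_isotropic_gaussian[OF assms(1)])
  \<comment> \<open>\<open>sum_indep_normal\<close> asks for a nonempty index set and positive
    standard deviations. Coordinates with \<open>d $ i = 0\<close> contribute nothing to the inner
    product and are dropped.\<close>
  define I where "I = {i. d $ i \<noteq> 0}"
  have I: "finite I" "I \<noteq> {}" using assms(2) by (auto simp: I_def vec_eq_iff)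
  have ind: "indep_vars (\<lambda>_. borel) (\<lambda>i z. d $ i * z $ i) I"
    by (rule indep_vars_compose2[OF indep_vars_subset[OF indep_vars_isotropic_gaussian[OF assms(1)]]]) auto
  have "distributed (isotropic_gaussian \<sigma>) lborel (\<lambda>z. \<Sum>i\<in>I. d $ i * z $ i)
     (normal_density (\<Sum>i\<in>I. 0) (sqrt (\<Sum>i\<in>I. (\<bar>d $ i\<bar> * \<sigma>)\<^sup>2)))"
  proof (rule sum_indep_normal[OF I ind])
    fix i assume "i \<in> I"
    hence i: "d $ i \<noteq> 0" by (simp add: I_def)
    thus "0 < \<bar>d $ i\<bar> * \<sigma>" using assms by simp
    show "distributed (isotropic_gaussian \<sigma>) lborel (\<lambda>z :: real ^ 'd. d $ i * z $ i) (normal_density 0 (\<bar>d $ i\<bar> * \<sigma>))"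
      using normal_density_affine[OF distributed_isotropic_gaussian_nth[OF assms(1), of i] assms(1) i, of 0] by simp
  qed
  moreover have "(\<Sum>i\<in>I. d $ i * z $ i) = z \<bullet> d" for z
    unfolding inner_vec_def I_def by (rule sum.mono_neutral_cong_left) auto
  moreover have "(\<Sum>i\<in>I. (\<bar>d $ i\<bar> * \<sigma>)\<^sup>2) = \<sigma>\<^sup>2 * (norm d)\<^sup>2"
  proof -
    have "(norm d)\<^sup>2 = (\<Sum>i\<in>I. (d $ i)\<^sup>2)"
      unfolding power2_norm_eq_inner inner_vec_def I_def
      by (rule sum.mono_neutral_cong_right) (auto simp: power2_eq_square)
    thus ?thesis by (simp add: power_mult_distrib sum_distrib_left mult.commute)
  qed
  ultimately have "distributed (isotropic_gaussian \<sigma>) lborel (\<lambda>z. z \<bullet> d) (normal_density 0 (\<sigma> * norm d))"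
    using assms by (simp add: real_sqrt_mult)
  hence "distributed (isotropic_gaussian \<sigma>) lborel (\<lambda>z. (z \<bullet> d) / (\<sigma> * norm d)) std_normal_density"
    using assms by (subst (asm) normal_standard_normal_convert) auto
  hence eq: "distr (isotropic_gaussian \<sigma>) lborel (\<lambda>z. (z \<bullet> d) / (\<sigma> * norm d)) = std_normal_distribution"
    by (simp add: distributed_def)
  have "std_normal_cdf (\<tau> / (\<sigma> * norm d)) =
     measure (distr (isotropic_gaussian \<sigma>) lborel (\<lambda>z. (z \<bullet> d) / (\<sigma> * norm d))) {..\<tau> / (\<sigma> * norm d)}"
    by (simp add: std_normal_cdf_def cdf_def eq)
  also have "\<dots> = measure (isotropic_gaussian \<sigma>) {z. z \<bullet> d \<le> \<tau>}"
    using assms by (subst measure_distr)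
      (auto intro!: arg_cong[of _ _ "measure (isotropic_gaussian \<sigma>)"] simp: divide_le_cancel mult_less_0_iff)
  finally show ?thesis ..
qed

text \<open>The likelihood ratio of the shifted to the unshifted density depends on \<open>z\<close>
  only through \<open>z \<bullet> d\<close> and increases with it. This is why half-spaces
  orthogonal to \<open>d\<close> are the extremal sets.\<close>

lemma gaussian_density_shift:
  assumes "\<sigma> > 0"
  shows "gaussian_density \<sigma> (z - d) =
    exp ((z \<bullet> d - (norm d)\<^sup>2 / 2) / \<sigma>\<^sup>2) * gaussian_density \<sigma> z"
proof -
  have "normal_density 0 \<sigma> (z $ i - d $ i) =
     exp ((z $ i * d $ i - (d $ i)\<^sup>2 / 2) / \<sigma>\<^sup>2) * normal_density 0 \<sigma> (z $ i)" for i
  proof -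
    have "- (z $ i - d $ i)\<^sup>2 / (2 * \<sigma>\<^sup>2) =
       (z $ i * d $ i - (d $ i)\<^sup>2 / 2) / \<sigma>\<^sup>2 + - (z $ i)\<^sup>2 / (2 * \<sigma>\<^sup>2)"
      using assms by (simp add: field_simps power2_eq_square)
    thus ?thesis by (simp add: normal_density_def exp_add[symmetric])
  qed
  moreover have "z \<bullet> d - (norm d)\<^sup>2 / 2 = (\<Sum>i\<in>UNIV. z $ i * d $ i - (d $ i)\<^sup>2 / 2)"
    unfolding power2_norm_eq_inner inner_vec_def sum_subtractf sum_divide_distrib
    by (simp add: power2_eq_square)
  ultimately show ?thesis
    by (simp add: gaussian_density_def prod.distrib exp_sum[symmetric] sum_divide_distrib)
qed

text \<open>The substitution \<open>z = d + e\<close> turns the mass of the shifted event into the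
  integral of the shifted density over \<open>A\<close>, that is, of the likelihood ratio against
  the unshifted Gaussian.\<close>

lemma emeasure_isotropic_gaussian_shift:
  fixes d :: "real ^ 'd"
  assumes "\<sigma> > 0" and [measurable]: "A \<in> sets borel"
  shows "emeasure (isotropic_gaussian \<sigma>) {e. d + e \<in> A} =
    (\<integral>\<^sup>+z\<in>A. ennreal (exp ((z \<bullet> d - (norm d)\<^sup>2 / 2) / \<sigma>\<^sup>2)) \<partial>isotropic_gaussian \<sigma>)"
proof -
  have "(\<integral>\<^sup>+z\<in>A. ennreal (exp ((z \<bullet> d - (norm d)\<^sup>2 / 2) / \<sigma>\<^sup>2)) \<partial>isotropic_gaussian \<sigma>) =
     (\<integral>\<^sup>+z. ennreal (gaussian_density \<sigma> (z - d)) * indicator A z \<partial>lborel)"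
    unfolding isotropic_gaussian_density gaussian_density_shift[OF assms(1)]
    by (subst nn_integral_density)
       (auto intro!: nn_integral_cong simp: ennreal_mult gaussian_density_nonneg mult_ac)
  also have "\<dots> = (\<integral>\<^sup>+z. ennreal (gaussian_density \<sigma> (z - d)) * indicator A z \<partial>distr lborel borel ((+) d))"
    by (simp add: lborel_distr_plus)
  also have "\<dots> = (\<integral>\<^sup>+e. ennreal (gaussian_density \<sigma> e) * indicator A (d + e) \<partial>lborel)"
    by (subst nn_integral_distr) auto
  also have "\<dots> = emeasure (isotropic_gaussian \<sigma>) {e. d + e \<in> A}"
    unfolding isotropic_gaussian_density
    by (subst emeasure_density) (auto intro!: nn_integral_cong simp: indicator_def)
  finally show ?thesis ..
qed

text \<open>Neyman--Pearson: among all sets of given Gaussian mass, the half-space on which the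
  likelihood ratio of the shifted to the unshifted density is smallest loses the most mass.\<close>

lemma isotropic_gaussian_shift_lower:
  fixes d :: "real ^ 'd"
  assumes \<sigma>: "\<sigma> > 0" and A [measurable]: "A \<in> sets borel" and p: "0 < p" "p < 1"
    and le: "p \<le> measure (isotropic_gaussian \<sigma>) A"
  shows "std_normal_cdf (inv std_normal_cdf p - norm d / \<sigma>) \<le> measure (isotropic_gaussian \<sigma>) {e. d + e \<in> A}"
proof (cases "d = 0")
  case True
  thus ?thesis using le std_normal_cdf_inv[OF p] by simp
next
  case False
  interpret prob_space "isotropic_gaussian \<sigma> :: (real ^ 'd) measure"
    by (rule prob_space_isotropic_gaussian[OF \<sigma>])
  \<comment> \<open>This threshold gives the half-space \<open>H\<close> Gaussian mass exactly
    \<open>p\<close>.\<close>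
  define \<tau> where "\<tau> = inv std_normal_cdf p * (\<sigma> * norm d)"
  define H where "H = {z. z \<bullet> d \<le> \<tau>}"
  define L where "L z = exp ((z \<bullet> d - (norm d)\<^sup>2 / 2) / \<sigma>\<^sup>2)" for z
  \<comment> \<open>\<open>K\<close> is the value of the likelihood ratio \<open>L\<close> on the
    boundary of \<open>H\<close>, so \<open>L \<le> K\<close> on \<open>H\<close> and
    \<open>L \<ge> K\<close> off it.\<close>
  define K where "K = exp ((\<tau> - (norm d)\<^sup>2 / 2) / \<sigma>\<^sup>2)"
  define Q where "Q B = emeasure (isotropic_gaussian \<sigma>) {e. d + e \<in> B}" for B
  have [measurable]: "H \<in> sets borel" by (simp add: H_def)
  have Q: "Q B = (\<integral>\<^sup>+z\<in>B. ennreal (L z) \<partial>isotropic_gaussian \<sigma>)" if "B \<in> sets borel" for B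
    unfolding Q_def L_def by (rule emeasure_isotropic_gaussian_shift[OF \<sigma> that])
  have Q_Un: "Q (B \<union> C) = Q B + Q C"
    if [measurable]: "B \<in> sets borel" "C \<in> sets borel" and "B \<inter> C = {}" for B C
  proof -
    have "{e. d + e \<in> B \<union> C} = {e. d + e \<in> B} \<union> {e. d + e \<in> C}" by auto
    moreover have "{e. d + e \<in> B} \<inter> {e. d + e \<in> C} = {}" using that by auto
    ultimately show ?thesis unfolding Q_def by (subst plus_emeasure) auto
  qed
  have PH: "prob H = p"
    unfolding H_def using False \<sigma> by (subst isotropic_gaussian_halfspace) (auto simp: \<tau>_def std_normal_cdf_inv[OF p])
  \<comment> \<open>Translating by \<open>d\<close> lowers the threshold of the half-space by
    \<open>d \<bullet> d\<close>.\<close>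
  have "measure (isotropic_gaussian \<sigma>) {e. d + e \<in> H} = std_normal_cdf ((\<tau> - (norm d)\<^sup>2) / (\<sigma> * norm d))"
    using False \<sigma> isotropic_gaussian_halfspace[of \<sigma> d "\<tau> - (norm d)\<^sup>2"]
    by (simp add: H_def inner_add_left power2_norm_eq_inner algebra_simps)
  also have "(\<tau> - (norm d)\<^sup>2) / (\<sigma> * norm d) = inv std_normal_cdf p - norm d / \<sigma>"
    using False \<sigma> by (simp add: \<tau>_def field_simps power2_eq_square)
  finally have QH: "Q H = ennreal (std_normal_cdf (inv std_normal_cdf p - norm d / \<sigma>))"
    by (simp add: Q_def emeasure_eq_measure)
  \<comment> \<open>Remove the common part of \<open>A\<close> and \<open>H\<close> from
    \<open>prob H = p \<le> prob A\<close>.\<close>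
  have "prob (H - A) \<le> prob (A - H)"
    using le PH by (simp add: finite_measure_Diff' Int_commute)
  hence diff: "emeasure (isotropic_gaussian \<sigma>) (H - A) \<le> emeasure (isotropic_gaussian \<sigma>) (A - H)"
    by (simp add: emeasure_eq_measure)
  have "Q (H - A) \<le> (\<integral>\<^sup>+z\<in>H - A. ennreal K \<partial>isotropic_gaussian \<sigma>)"
    using \<sigma>
    by (subst Q, simp) (auto intro!: nn_integral_mono ennreal_leI divide_right_mono simp: indicator_def L_def K_def H_def)
  also have "\<dots> = ennreal K * emeasure (isotropic_gaussian \<sigma>) (H - A)"
    by (simp add: nn_integral_cmult_indicator)
  also have "\<dots> \<le> ennreal K * emeasure (isotropic_gaussian \<sigma>) (A - H)"
    by (rule mult_left_mono[OF diff]) simp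
  also have "\<dots> = (\<integral>\<^sup>+z\<in>A - H. ennreal K \<partial>isotropic_gaussian \<sigma>)"
    by (simp add: nn_integral_cmult_indicator)
  also have "\<dots> \<le> Q (A - H)"
    using \<sigma>
    by (subst Q, simp) (auto intro!: nn_integral_mono ennreal_leI divide_right_mono simp: indicator_def L_def K_def H_def)
  finally have "Q (H \<inter> A) + Q (H - A) \<le> Q (H \<inter> A) + Q (A - H)"
    by (rule add_left_mono)
  moreover have "Q (H \<inter> A) + Q (H - A) = Q H"
    by (subst Q_Un[symmetric]) (auto intro!: arg_cong[of _ _ Q])
  moreover have "Q (H \<inter> A) + Q (A - H) = Q A"
    by (subst Q_Un[symmetric]) (auto intro!: arg_cong[of _ _ Q])
  ultimately have "Q H \<le> Q A" by simp
  thus ?thesis by (simp add: QH) (simp add: Q_def emeasure_eq_measure)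
qed

text \<open>Apply the lower bound to the complement of \<open>A\<close> with \<open>1 - p\<close>,
  and reflect back with the symmetry of the distribution function.\<close>

lemma isotropic_gaussian_shift_upper:
  fixes d :: "real ^ 'd"
  assumes \<sigma>: "\<sigma> > 0" and A [measurable]: "A \<in> sets borel" and p: "0 < p" "p < 1"
    and le: "measure (isotropic_gaussian \<sigma>) A \<le> p"
  shows "measure (isotropic_gaussian \<sigma>) {e. d + e \<in> A} \<le> std_normal_cdf (inv std_normal_cdf p + norm d / \<sigma>)"
proof -
  interpret prob_space "isotropic_gaussian \<sigma> :: (real ^ 'd) measure"
    by (rule prob_space_isotropic_gaussian[OF \<sigma>])
  have "1 - p \<le> prob (- A)" using le prob_compl[of A] by (simp add: Compl_eq_Diff_UNIV)
  hence "std_normal_cdf (inv std_normal_cdf (1 - p) - norm d / \<sigma>) \<le> prob {e. d + e \<in> - A}"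
    using p \<sigma> by (intro isotropic_gaussian_shift_lower) auto
  also have "{e. d + e \<in> - A} = space (isotropic_gaussian \<sigma>) - {e. d + e \<in> A}" by auto
  also have "prob \<dots> = 1 - prob {e. d + e \<in> A}" by (rule prob_compl) simp
  finally show ?thesis
    using std_normal_cdf_uminus[of "inv std_normal_cdf p + norm d / \<sigma>"]
    by (simp add: std_normal_cdf_inv_compl[OF p])
qed

subsection \<open>Clopper--Pearson bounds\<close>

definition binomial_tail :: "nat \<Rightarrow> nat \<Rightarrow> real \<Rightarrow> real" where
  "binomial_tail n m y = (\<Sum>j=m..n. real (n choose j) * y ^ j * (1 - y) ^ (n - j))"

lemma continuous_on_binomial_tail: "continuous_on UNIV (binomial_tail n m)"
  unfolding binomial_tail_def [abs_def] by (intro continuous_intros)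

lemma binomial_tail_0: "m \<ge> 1 \<Longrightarrow> binomial_tail n m 0 = 0"
  unfolding binomial_tail_def by (intro sum.neutral) auto

lemma binomial_tail_1: "m \<le> n \<Longrightarrow> binomial_tail n m 1 = 1"
proof -
  assume "m \<le> n"
  have "binomial_tail n m 1 = (\<Sum>j=m..n. if j = n then 1 else 0)"
    unfolding binomial_tail_def by (intro sum.cong) auto
  thus ?thesis using \<open>m \<le> n\<close> by simp
qed

text \<open>The derivatives of the summands telescope. Downward induction on \<open>m\<close> adds
  one summand at a time, starting from \<open>y ^ n\<close>.\<close>

lemma DERIV_binomial_tail:
  assumes "1 \<le> m" "m \<le> n"
  shows "(binomial_tail n m has_real_derivative
     real m * real (n choose m) * y ^ (m - 1) * (1 - y) ^ (n - m)) (at y)"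
  using assms(2,1)
proof (induction m rule: inc_induct)
  case base
  have "binomial_tail n n = (\<lambda>y. y ^ n)" by (simp add: binomial_tail_def fun_eq_iff)
  thus ?case by (auto intro!: derivative_eq_intros)
next
  case (step m)
  have eq: "binomial_tail n m = (\<lambda>y. real (n choose m) * y ^ m * (1 - y) ^ (n - m) + binomial_tail n (Suc m) y)"
    using step by (simp add: binomial_tail_def fun_eq_iff sum.atLeast_Suc_atMost)
  \<comment> \<open>By this identity the negative half of the derivative of the new summand cancels
    the derivative of the tail from \<open>Suc m\<close>.\<close>
  have 1: "real (Suc m) * real (n choose Suc m) = real (n - m) * real (n choose m)"
    using binomial_absorb_comp[of n m] Suc_times_binomial_add[of m "n - m - 1"] step
    by (metis (no_types, lifting) binomial_absorption mult.commute of_nat_mult)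
  have "((\<lambda>y. real (n choose m) * y ^ m * (1 - y) ^ (n - m) + binomial_tail n (Suc m) y) has_real_derivative
     (real (n choose m) * (real m * y ^ (m - 1)) * (1 - y) ^ (n - m)
      + real (n choose m) * y ^ m * (- (real (n - m) * (1 - y) ^ (n - m - 1))))
     + real (Suc m) * real (n choose Suc m) * y ^ (Suc m - 1) * (1 - y) ^ (n - Suc m)) (at y)"
    by (rule derivative_eq_intros refl step)+ (use step in \<open>auto simp: algebra_simps\<close>)
  thus ?case unfolding eq 1 by (simp add: algebra_simps)
qed

text \<open>This identifies the coefficient in the derivative of the binomial tail with the
  normalising constant of the Beta density.\<close>

lemma Beta_of_nat:
  assumes "1 \<le> m" "m \<le> n"
  shows "1 / Beta (real m) (real n - real m + 1) = real m * real (n choose m)"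
proof -
  have "Gamma (real m) = fact (m - 1)" using assms Gamma_fact[of "m - 1", where 'a = real] by (simp add: of_nat_diff)
  moreover have "Gamma (real n - real m + 1) = fact (n - m)"
    using assms Gamma_fact[of "n - m", where 'a = real] by (simp add: of_nat_diff add_ac)
  moreover have "Gamma (real m + (real n - real m + 1)) = fact n"
    using assms Gamma_fact[of "n", where 'a = real] by (simp add: add_ac)
  moreover have "fact m = real m * fact (m - 1)" using assms by (simp add: fact_reduce)
  ultimately show ?thesis
    using assms by (simp add: Beta_def binomial_fact field_simps)
qed

text \<open>The Beta density is the derivative of the binomial tail, which vanishes at 0, so the
  fundamental theorem of calculus applies.\<close>

lemma emeasure_beta_distribution:
  assumes "1 \<le> m" "m \<le> n" "0 \<le> y" "y \<le> 1"
  shows "emeasure (beta_distribution (real m) (real n - real m + 1)) {..y} = ennreal (binomial_tail n m y)"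
proof -
  let ?f = "\<lambda>y. real m * real (n choose m) * y ^ (m - 1) * (1 - y) ^ (n - m)"
  have "emeasure (beta_distribution (real m) (real n - real m + 1)) {..y} =
     (\<integral>\<^sup>+z. ennreal (?f z) * indicator {0..y} z \<partial>lborel)"
    unfolding beta_distribution_def
  proof (subst emeasure_density, simp, simp, rule nn_integral_cong_AE)
    \<comment> \<open>The Beta density is cut off to the open interval, while the polynomial can be
      nonzero at 0 (if \<open>m = 1\<close>) and at 1 (if \<open>m = n\<close>).\<close>
    have "AE z in lborel. z \<noteq> 0 \<and> z \<noteq> (1::real)" by (simp add: AE_lborel_singleton)
    thus "AE z in lborel. ennreal (indicator {0<..<1} z *
         (z powr (real m - 1) * (1 - z) powr (real n - real m + 1 - 1) / Beta (real m) (real n - real m + 1))) *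
         indicator {..y} z = ennreal (?f z) * indicator {0..y} z"
    proof eventually_elim
      case (elim z)
      show ?case
      proof (cases "z \<in> {0<..<1}")
        case True
        have "z powr (real m - 1) = z ^ (m - 1)"
          using True assms powr_realpow[of z "m - 1"] by (simp add: of_nat_diff)
        moreover have "(1 - z) powr (real n - real m + 1 - 1) = (1 - z) ^ (n - m)"
          using True assms powr_realpow[of "1 - z" "n - m"] by (simp add: of_nat_diff)
        ultimately have "z powr (real m - 1) * (1 - z) powr (real n - real m + 1 - 1) / Beta (real m) (real n - real m + 1)
           = ?f z"
          using Beta_of_nat[OF assms(1,2)] by (simp add: divide_inverse mult_ac)
        thus ?thesis using True by (simp add: indicator_def)
      qed (use elim assms in \<open>auto simp: indicator_def\<close>)
    qed
  qed
  also have "\<dots> = ennreal (binomial_tail n m y - binomial_tail n m 0)"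
    using assms by (intro nn_integral_FTC_Icc DERIV_binomial_tail) auto
  also have "\<dots> = ennreal (binomial_tail n m y)" using assms by (simp add: binomial_tail_0)
  finally show ?thesis .
qed

lemma binomial_tail_nonneg: "0 \<le> y \<Longrightarrow> y \<le> 1 \<Longrightarrow> 0 \<le> binomial_tail n m y"
  unfolding binomial_tail_def by (intro sum_nonneg) auto

lemma cdf_beta_distribution:
  assumes "1 \<le> m" "m \<le> n" "0 \<le> y" "y \<le> 1"
  shows "cdf (beta_distribution (real m) (real n - real m + 1)) y = binomial_tail n m y"
  using emeasure_beta_distribution[OF assms] binomial_tail_nonneg[of y n m] assms
  by (simp add: cdf_def measure_def)

lemma cdf_beta_distribution_nonpos:
  assumes "y \<le> 0"
  shows "cdf (beta_distribution u v) y = 0"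
proof -
  have "emeasure (beta_distribution u v) {..y} = (\<integral>\<^sup>+z. 0 \<partial>(lborel :: real measure))"
    unfolding beta_distribution_def
  proof (subst emeasure_density, simp, simp, rule nn_integral_cong)
    fix z :: real
    show "ennreal (indicator {0<..<1} z * (z powr (u - 1) * (1 - z) powr (v - 1) / Beta u v)) *
        indicator {..y} z = 0"
      using assms by (cases "z \<le> y") auto
  qed
  thus ?thesis by (simp add: cdf_def measure_def)
qed

lemma binomial_tail_mono:
  assumes "1 \<le> m" "m \<le> n" "0 \<le> x" "x \<le> y" "y \<le> 1"
  shows "binomial_tail n m x \<le> binomial_tail n m y"
  using assms(4)
proof (rule DERIV_nonneg_imp_nondecreasing)
  fix z assume "x \<le> z" "z \<le> y"
  thus "\<exists>D. (binomial_tail n m has_real_derivative D) (at z) \<and> D \<ge> 0"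
    using assms
    by (intro exI[of _ "real m * real (n choose m) * z ^ (m - 1) * (1 - z) ^ (n - m)"] conjI DERIV_binomial_tail) auto
qed

text \<open>The binomial tail is continuous with values 0 and 1 at the endpoints, so the level
  \<open>\<beta>\<close> is crossed strictly inside the unit interval. Strictness is needed because
  \<open>inv std_normal_cdf\<close> is applied to the lower confidence bound.\<close>

lemma beta_quantile_set:
  assumes "1 \<le> m" "m \<le> n" "0 < \<beta>" "\<beta> < 1"
  defines "S \<equiv> {y. \<beta> \<le> cdf (beta_distribution (real m) (real n - real m + 1)) y}"
  shows "bdd_below S" and "\<exists>\<epsilon>>0. \<forall>y\<in>S. \<epsilon> \<le> y" and "\<exists>y\<in>S. y < 1"
proof -
  have "isCont (binomial_tail n m) 0" 
    using continuous_on_binomial_tail by (simp add: continuous_on_eq_continuous_at)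
  hence "((binomial_tail n m) \<longlongrightarrow> 0) (at 0)"
    using binomial_tail_0[OF assms(1), of n] by (simp add: isCont_def)
  hence "eventually (\<lambda>y. binomial_tail n m y < \<beta>) (at_right 0)"
    using assms(3) by (intro order_tendstoD) (auto simp: filterlim_at_split)
  then obtain b where b: "b > 0" "\<And>y. y > 0 \<Longrightarrow> y < b \<Longrightarrow> binomial_tail n m y < \<beta>"
    by (auto simp: eventually_at_right_field)
  \<comment> \<open>The cap at 1 keeps \<open>y\<close> where the distribution function is known to
    be the binomial tail.\<close>
  have low: "min b 1 \<le> y" if "y \<in> S" for y
  proof (rule ccontr)
    assume "\<not> min b 1 \<le> y"
    hence "y < b" "y < 1" by auto
    moreover have "0 < y"
      using that cdf_beta_distribution_nonpos[of y "real m" "real n - real m + 1"] assms(3)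
      by (cases "y \<le> 0") (auto simp: S_def)
    ultimately show False
      using b(2)[of y] that assms by (simp add: S_def cdf_beta_distribution)
  qed
  show "\<exists>\<epsilon>>0. \<forall>y\<in>S. \<epsilon> \<le> y" using low b(1) by (intro exI[of _ "min b 1"]) auto
  show "bdd_below S" using low by (intro bdd_belowI[of _ "min b 1"]) auto
  have "isCont (binomial_tail n m) 1" 
    using continuous_on_binomial_tail by (simp add: continuous_on_eq_continuous_at)
  hence "((binomial_tail n m) \<longlongrightarrow> 1) (at 1)"
    using binomial_tail_1[OF assms(2)] by (simp add: isCont_def)
  hence "eventually (\<lambda>y. binomial_tail n m y > \<beta>) (at_left 1)"
    using assms(4) by (intro order_tendstoD) (auto simp: filterlim_at_split)
  then obtain a where a: "a < 1" "\<And>y. y > a \<Longrightarrow> y < 1 \<Longrightarrow> binomial_tail n m y > \<beta>"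
    by (auto simp: eventually_at_left_field)
  obtain y where y: "max a 0 < y" "y < 1" using dense[of "max a 0" 1] a(1) by auto
  hence "y \<in> S" using a(2)[of y] assms by (simp add: S_def cdf_beta_distribution)
  thus "\<exists>y\<in>S. y < 1" using y by auto
qed

lemma beta_quantile_bounds:
  assumes "1 \<le> m" "m \<le> n" "0 < \<beta>" "\<beta> < 1"
  shows "0 < beta_quantile \<beta> (real m) (real n - real m + 1)"
    and "beta_quantile \<beta> (real m) (real n - real m + 1) < 1"
proof -
  let ?S = "{y. \<beta> \<le> cdf (beta_distribution (real m) (real n - real m + 1)) y}"
  have eq: "beta_quantile \<beta> (real m) (real n - real m + 1) = Inf ?S"
    using assms by (simp add: beta_quantile_def quantile_def)
  obtain y where y: "y \<in> ?S" "y < 1" using beta_quantile_set(3)[OF assms] by blast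
  obtain e where e: "e > 0" "\<forall>y\<in>?S. e \<le> y" using beta_quantile_set(2)[OF assms] by blast
  have "e \<le> Inf ?S" using y e by (intro cInf_greatest) auto
  thus "0 < beta_quantile \<beta> (real m) (real n - real m + 1)" using e eq by simp
  have "Inf ?S \<le> y" using y beta_quantile_set(1)[OF assms] by (intro cInf_lower) auto
  thus "beta_quantile \<beta> (real m) (real n - real m + 1) < 1" using y eq by simp
qed

lemma less_beta_quantileD:
  assumes "1 \<le> m" "m \<le> n" "0 < \<beta>" "\<beta> < 1" "0 \<le> p" "p \<le> 1"
    and "p < beta_quantile \<beta> (real m) (real n - real m + 1)"
  shows "binomial_tail n m p < \<beta>"
proof (rule ccontr)
  assume "\<not> ?thesis"
  hence "p \<in> {y. \<beta> \<le> cdf (beta_distribution (real m) (real n - real m + 1)) y}"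
    using assms by (simp add: cdf_beta_distribution)
  hence "Inf {y. \<beta> \<le> cdf (beta_distribution (real m) (real n - real m + 1)) y} \<le> p"
    by (rule cInf_lower[OF _ beta_quantile_set(1)[OF assms(1-4)]])
  thus False using assms by (simp add: beta_quantile_def quantile_def)
qed

text \<open>A point above the infimum has a member of the set below it, and monotonicity of the tail
  carries the level \<open>\<beta>\<close> from there up to \<open>p\<close>.\<close>

lemma greater_beta_quantileD:
  assumes "1 \<le> m" "m \<le> n" "0 < \<beta>" "\<beta> < 1" "0 \<le> p" "p \<le> 1"
    and "p > beta_quantile \<beta> (real m) (real n - real m + 1)"
  shows "\<beta> \<le> binomial_tail n m p"
proof -
  let ?S = "{y. \<beta> \<le> cdf (beta_distribution (real m) (real n - real m + 1)) y}"
  have "Inf ?S < p" using assms by (simp add: beta_quantile_def quantile_def)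
  moreover have "?S \<noteq> {}" using beta_quantile_set(3)[OF assms(1-4)] by blast
  ultimately obtain y where y: "y \<in> ?S" "y < p"
    using beta_quantile_set(1)[OF assms(1-4)] by (auto simp: cInf_less_iff)
  have "0 < y"
    using y cdf_beta_distribution_nonpos[of y "real m" "real n - real m + 1"] assms(3)
    by (cases "y \<le> 0") auto
  hence "\<beta> \<le> binomial_tail n m y" using y assms by (simp add: cdf_beta_distribution)
  also have "\<dots> \<le> binomial_tail n m p" using y \<open>0 < y\<close> assms by (intro binomial_tail_mono) auto
  finally show ?thesis .
qed

section \<open>Counts of independent labels and their confidence bounds\<close>

lemma (in prob_space) events_finite_valued:
  assumes "finite I" "finite S" "\<And>i. i \<in> I \<Longrightarrow> Y i \<in> M \<rightarrow>\<^sub>M count_space S"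
  shows "{\<omega> \<in> space M. Q (\<lambda>i\<in>I. Y i \<omega>)} \<in> events"
proof -
  \<comment> \<open>The tuple of labels takes values in a finite discrete space, so every predicate
    \<open>Q\<close> of it defines an event.\<close>
  have "(\<lambda>\<omega>. \<lambda>i\<in>I. Y i \<omega>) \<in> M \<rightarrow>\<^sub>M count_space (PiE I (\<lambda>_. S))"
    using measurable_restrict[of I Y M "\<lambda>_. count_space S"] assms
    by (simp add: count_space_PiM_finite countable_finite)
  from measurable_sets[OF this, of "{y \<in> PiE I (\<lambda>_. S). Q y}"] measurable_space[OF this]
  show ?thesis by (auto elim!: back_subst[of "\<lambda>A. A \<in> events"])
qed

text \<open>The label comes last, so that \<open>occurrences Y I \<omega>\<close> is the whole count
  function, the form in which \<open>lower_bound\<close> and \<open>upper_bound\<close> take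
  it.\<close>

definition occurrences :: "('i \<Rightarrow> 'w \<Rightarrow> 'a) \<Rightarrow> 'i set \<Rightarrow> 'w \<Rightarrow> 'a \<Rightarrow> nat" where
  "occurrences Y I \<omega> a = (\<Sum>i\<in>I. of_bool (Y i \<omega> = a))"

lemma occurrences_le: "finite I \<Longrightarrow> occurrences Y I \<omega> a \<le> card I"
  unfolding occurrences_def using sum_bounded_above[of I "\<lambda>i. of_bool (Y i \<omega> = a) :: nat" 1] by simp

text \<open>The counts are a function of the label tuple. An arbitrary \<open>Q\<close> is allowed
  so that the event of correct certification is covered too.\<close>

lemma (in prob_space) events_occurrences:
  assumes "finite I" "finite S" "\<And>i. i \<in> I \<Longrightarrow> Y i \<in> M \<rightarrow>\<^sub>M count_space S"
  shows "{\<omega> \<in> space M. Q (occurrences Y I \<omega>)} \<in> events"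
proof -
  have "occurrences Y I \<omega> = (\<lambda>a. \<Sum>i\<in>I. of_bool ((\<lambda>i\<in>I. Y i \<omega>) i = a))" for \<omega>
    unfolding occurrences_def by (intro ext sum.cong) auto
  thus ?thesis
    using events_finite_valued[OF assms, where Q = "\<lambda>y. Q (\<lambda>a. \<Sum>i\<in>I. of_bool (y i = a))"] by simp
qed

text \<open>\<open>P\<close> is the common law of the labels, given by its point masses. The bounds
  on it are assumed separately, since the link to \<open>prob\<close> is vacuous for an empty
  \<open>I\<close>.\<close>

locale iid_labels = prob_space M for M :: "'w measure" +
  fixes I :: "'i set" and S :: "'a set" and Y :: "'i \<Rightarrow> 'w \<Rightarrow> 'a" and P :: "'a \<Rightarrow> real"
  assumes I: "finite I" and S: "finite S"
    and indep: "indep_vars (\<lambda>_. count_space S) Y I"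
    and P: "\<And>i a. i \<in> I \<Longrightarrow> a \<in> S \<Longrightarrow> prob (Y i -` {a} \<inter> space M) = P a"
    and P_bounds: "\<And>a. a \<in> S \<Longrightarrow> 0 \<le> P a" "\<And>a. a \<in> S \<Longrightarrow> P a \<le> 1"
begin

lemma measurable_label: "i \<in> I \<Longrightarrow> Y i \<in> M \<rightarrow>\<^sub>M count_space S"
  using indep by (simp add: indep_vars_def)

lemma events_counts [simp, intro]: "{\<omega> \<in> space M. Q (occurrences Y I \<omega>)} \<in> events"
  by (rule events_occurrences[OF I S measurable_label])

lemma prob_occurrence_set:
  assumes a: "a \<in> S" and J: "J \<subseteq> I"
  shows "prob {\<omega> \<in> space M. {i\<in>I. Y i \<omega> = a} = J} = P a ^ card J * (1 - P a) ^ (card I - card J)"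
\<comment> \<open>Over an empty index set the intersection below would be \<open>UNIV\<close>
  instead of \<open>space M\<close>.\<close>
proof (cases "I = {}")
  case True
  thus ?thesis using J by (simp add: prob_space)
next
  case False
  let ?A = "\<lambda>i. if i \<in> J then {a} else S - {a}"
  have "{\<omega> \<in> space M. {i\<in>I. Y i \<omega> = a} = J} = (\<Inter>i\<in>I. Y i -` ?A i \<inter> space M)"
    using False J measurable_space[OF measurable_label] by (fastforce split: if_splits)
  also have "prob \<dots> = (\<Prod>i\<in>I. prob (Y i -` ?A i \<inter> space M))"
    by (rule indep_varsD_finite[OF indep False I]) (use a in auto)
  also have "\<dots> = (\<Prod>i\<in>I. if i \<in> J then P a else 1 - P a)"
  proof (rule prod.cong)
    fix i assume i: "i \<in> I"
    have "Y i -` (S - {a}) \<inter> space M = space M - (Y i -` {a} \<inter> space M)"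
      using measurable_space[OF measurable_label[OF i]] by auto
    moreover have "Y i -` {a} \<inter> space M \<in> events"
      using measurable_sets[OF measurable_label[OF i], of "{a}"] a by simp
    ultimately have "prob (Y i -` (S - {a}) \<inter> space M) = 1 - P a"
      using P[OF i a] by (simp add: prob_compl)
    thus "prob (Y i -` ?A i \<inter> space M) = (if i \<in> J then P a else 1 - P a)"
      using P[OF i a] by simp
  qed simp
  also have "\<dots> = P a ^ card (I \<inter> J) * (1 - P a) ^ card (I - J)"
    using I by (simp add: prod.If_cases Diff_eq)
  also have "I \<inter> J = J" using J by auto
  also have "card (I - J) = card I - card J"
    using J I by (simp add: card_Diff_subset finite_subset)
  finally show ?thesis .
qed

text \<open>Split the event by the exact set of indices carrying the label \<open>a\<close>; each
  set of size \<open>j\<close> has the same probability.\<close>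

lemma prob_occurrences_eq:
  assumes a: "a \<in> S"
  shows "prob {\<omega> \<in> space M. occurrences Y I \<omega> a = j} =
    real (card I choose j) * P a ^ j * (1 - P a) ^ (card I - j)"
proof -
  let ?E = "\<lambda>J. {\<omega> \<in> space M. {i\<in>I. Y i \<omega> = a} = J}"
  let ?\<J> = "{J. J \<subseteq> I \<and> card J = j}"
  have occ: "occurrences Y I \<omega> a = card {i\<in>I. Y i \<omega> = a}" for \<omega>
    using I by (simp add: occurrences_def of_bool_def sum.If_cases Int_def)
  have "{\<omega> \<in> space M. occurrences Y I \<omega> a = j} = (\<Union>J\<in>?\<J>. ?E J)"
    unfolding occ by auto
  also have "prob \<dots> = (\<Sum>J\<in>?\<J>. prob (?E J))"
  proof (rule finite_measure_finite_Union)
    show "finite ?\<J>" using I by simp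
    show "disjoint_family_on ?E ?\<J>" by (auto simp: disjoint_family_on_def)
    have "?E J \<in> events" if "J \<subseteq> I" for J
    proof -
      have "?E J = {\<omega> \<in> space M. {i\<in>I. (\<lambda>i\<in>I. Y i \<omega>) i = a} = J}"
        by (auto simp: restrict_def)
      also have "\<dots> \<in> events"
        by (rule events_finite_valued[OF I S measurable_label, where Q = "\<lambda>y. {i\<in>I. y i = a} = J"])
      finally show ?thesis .
    qed
    thus "?E ` ?\<J> \<subseteq> events" by auto
  qed
  also have "\<dots> = (\<Sum>J\<in>?\<J>. P a ^ j * (1 - P a) ^ (card I - j))"
    by (intro sum.cong refl) (auto simp: prob_occurrence_set[OF a])
  also have "\<dots> = real (card I choose j) * P a ^ j * (1 - P a) ^ (card I - j)"
    using n_subsets[OF I, of j] by simp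
  finally show ?thesis .
qed

lemma prob_occurrences_ge:
  assumes a: "a \<in> S"
  shows "prob {\<omega> \<in> space M. m \<le> occurrences Y I \<omega> a} = binomial_tail (card I) m (P a)"
proof -
  have "{\<omega> \<in> space M. m \<le> occurrences Y I \<omega> a} =
      (\<Union>j\<in>{m..card I}. {\<omega> \<in> space M. occurrences Y I \<omega> a = j})"
    using occurrences_le[OF I] by auto
  also have "prob \<dots> = (\<Sum>j=m..card I. prob {\<omega> \<in> space M. occurrences Y I \<omega> a = j})"
    by (rule finite_measure_finite_Union)
       (auto simp: disjoint_family_on_def intro!: events_counts[where Q = "\<lambda>N. N a = _"])
  also have "\<dots> = binomial_tail (card I) m (P a)"
    unfolding binomial_tail_def by (simp add: prob_occurrences_eq[OF a])
  finally show ?thesis .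
qed

text \<open>A count \<open>m\<close> whose bound overshoots \<open>P a\<close> has a tail at
  \<open>m\<close> below \<open>\<beta>\<close>; \<open>B\<close> collects all counts with this
  property. Failure forces the count to be at least \<open>Min B\<close>, and the probability of
  that is the tail at \<open>Min B\<close>, itself below \<open>\<beta>\<close>.\<close>

lemma clopper_pearson_lower:
  assumes a: "a \<in> S" and \<beta>: "0 < \<beta>" "\<beta> < 1"
  shows "prob {\<omega> \<in> space M. P a < beta_quantile \<beta> (real (occurrences Y I \<omega> a))
     (real (card I) - real (occurrences Y I \<omega> a) + 1)} \<le> \<beta>"
proof -
  let ?E = "{\<omega> \<in> space M. P a < beta_quantile \<beta> (real (occurrences Y I \<omega> a))
     (real (card I) - real (occurrences Y I \<omega> a) + 1)}"
  define B where "B = {m \<in> {1..card I}. binomial_tail (card I) m (P a) < \<beta>}"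
  have B: "occurrences Y I \<omega> a \<in> B" if "\<omega> \<in> ?E" for \<omega>
  proof -
    \<comment> \<open>At count 0 the convention makes the bound 0, which never exceeds
      \<open>P a\<close>.\<close>
    have "occurrences Y I \<omega> a \<noteq> 0"
      using that P_bounds(1)[OF a]
      by (cases "occurrences Y I \<omega> a = 0") (auto simp: beta_quantile_def)
    thus ?thesis
      using that less_beta_quantileD[of "occurrences Y I \<omega> a" "card I" \<beta> "P a"]
        occurrences_le[OF I, of Y \<omega> a] \<beta> P_bounds[OF a] by (auto simp: B_def)
  qed
  have fin: "finite B" by (simp add: B_def)
  show ?thesis
  proof (cases "B = {}")
    case True
    hence "?E = {}" using B by blast
    hence "prob ?E = 0" by (metis measure_empty)
    thus ?thesis using \<beta> by simp
  next
    case False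
    have "?E \<subseteq> {\<omega> \<in> space M. Min B \<le> occurrences Y I \<omega> a}"
      using B fin by auto
    hence "prob ?E \<le> prob {\<omega> \<in> space M. Min B \<le> occurrences Y I \<omega> a}"
      by (rule finite_measure_mono) (rule events_counts[where Q = "\<lambda>N. _ \<le> N a"])
    also have "\<dots> < \<beta>"
      using Min_in[OF fin False] by (simp add: prob_occurrences_ge[OF a] B_def)
    finally show ?thesis by simp
  qed
qed

text \<open>Mirror image of the lower bound: failure forces the count to be at most
  \<open>Max B\<close>, an event of probability one minus the tail at \<open>Suc (Max B)\<close>.
  The successor stems from the first Beta parameter being the count plus one.\<close>

lemma clopper_pearson_upper:
  assumes a: "a \<in> S" and \<beta>: "0 < \<beta>" "\<beta> < 1"
  shows "prob {\<omega> \<in> space M. beta_quantile (1 - \<beta>) (real (occurrences Y I \<omega> a) + 1)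
     (real (card I) - real (occurrences Y I \<omega> a)) < P a} \<le> \<beta>"
proof -
  let ?E = "{\<omega> \<in> space M. beta_quantile (1 - \<beta>) (real (occurrences Y I \<omega> a) + 1)
     (real (card I) - real (occurrences Y I \<omega> a)) < P a}"
  define B where "B = {m \<in> {..<card I}. 1 - \<beta> \<le> binomial_tail (card I) (Suc m) (P a)}"
  have B: "occurrences Y I \<omega> a \<in> B" if "\<omega> \<in> ?E" for \<omega>
  proof -
    \<comment> \<open>At full count the convention makes the bound 1, which \<open>P a\<close> never
      exceeds.\<close>
    have "occurrences Y I \<omega> a \<noteq> card I"
      using that P_bounds(2)[OF a] by (auto simp: beta_quantile_def split: if_splits)
    thus ?thesis
      using that greater_beta_quantileD[of "Suc (occurrences Y I \<omega> a)" "card I" "1 - \<beta>" "P a"]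
        occurrences_le[OF I, of Y \<omega> a] \<beta> P_bounds[OF a] by (auto simp: B_def add_ac)
  qed
  have fin: "finite B" by (simp add: B_def)
  show ?thesis
  proof (cases "B = {}")
    case True
    hence "?E = {}" using B by blast
    hence "prob ?E = 0" by (metis measure_empty)
    thus ?thesis using \<beta> by simp
  next
    case False
    let ?F = "{\<omega> \<in> space M. Suc (Max B) \<le> occurrences Y I \<omega> a}"
    have F: "?F \<in> events" by (rule events_counts[where Q = "\<lambda>N. _ \<le> N a"])
    have "occurrences Y I \<omega> a \<le> Max B" if "\<omega> \<in> ?E" for \<omega>
      using B[OF that] fin by simp
    hence "?E \<subseteq> space M - ?F" by fastforce
    hence "prob ?E \<le> prob (space M - ?F)"
      by (rule finite_measure_mono) (use F in auto)
    also have "\<dots> = 1 - binomial_tail (card I) (Suc (Max B)) (P a)"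
      using F by (simp add: prob_compl prob_occurrences_ge[OF a])
    also have "\<dots> \<le> \<beta>"
      using Max_in[OF fin False] by (simp add: B_def)
    finally show ?thesis .
  qed
qed

end

subsection \<open>Certified radii\<close>

lemma label_count_le: "label_count f x n e i \<le> n"
  unfolding label_count_def using sum_bounded_above[of "{1..n}" "\<lambda>j. of_bool (f (x + e j) = i) :: nat" 1] by simp

lemma label_set_measurable:
  assumes "f \<in> borel \<rightarrow>\<^sub>M count_space {1..c :: nat}"
  shows "{e :: real ^ 'd. f (z + e) \<in> S} \<in> sets borel"
proof -
  have "(\<lambda>e. f (z + e)) \<in> borel \<rightarrow>\<^sub>M count_space {1..c}"
    by (rule measurable_compose[OF _ assms]) simp
  from measurable_sets[OF this, of "S \<inter> {1..c}"] measurable_space[OF this]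
  show ?thesis by (auto elim!: back_subst[of "\<lambda>A. A \<in> sets borel"])
qed

lemma measure_label_set:
  fixes f :: "real ^ 'd \<Rightarrow> nat"
  assumes f: "f \<in> borel \<rightarrow>\<^sub>M count_space {1..c}" and "\<sigma> > 0" "finite S"
  shows "measure (isotropic_gaussian \<sigma>) {e. f (z + e) \<in> S} = (\<Sum>i\<in>S. label_prob f \<sigma> z i)"
proof -
  interpret prob_space "isotropic_gaussian \<sigma> :: (real ^ 'd) measure"
    by (rule prob_space_isotropic_gaussian[OF assms(2)])
  have "{e. f (z + e) \<in> S} = (\<Union>i\<in>S. {e. f (z + e) = i})" by auto
  also have "prob \<dots> = (\<Sum>i\<in>S. prob {e. f (z + e) = i})"
    using label_set_measurable[OF f, of z "{_}"]
    by (intro finite_measure_finite_Union) (auto simp: disjoint_family_on_def assms)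
  finally show ?thesis by (simp add: label_prob_def)
qed

lemma label_prob_bounds:
  assumes "\<sigma> > 0"
  shows "0 \<le> label_prob f \<sigma> z i" "label_prob f \<sigma> z i \<le> 1"
proof -
  interpret prob_space "isotropic_gaussian \<sigma> :: (real ^ 'd) measure"
    by (rule prob_space_isotropic_gaussian[OF assms])
  show "0 \<le> label_prob f \<sigma> z i" "label_prob f \<sigma> z i \<le> 1" by (simp_all add: label_prob_def)
qed

text \<open>This justifies the cap \<open>1 - p\<close> in \<open>sum_bound\<close> and the upper
  bounds of \<open>BINOCP\<close>.\<close>

lemma sum_label_prob_le:
  fixes f :: "real ^ 'd \<Rightarrow> nat"
  assumes f: "f \<in> borel \<rightarrow>\<^sub>M count_space {1..c}" and "\<sigma> > 0" "finite S" "l \<notin> S"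
  shows "(\<Sum>i\<in>S. label_prob f \<sigma> z i) \<le> 1 - label_prob f \<sigma> z l"
proof -
  interpret prob_space "isotropic_gaussian \<sigma> :: (real ^ 'd) measure"
    by (rule prob_space_isotropic_gaussian[OF assms(2)])
  have "(\<Sum>i\<in>insert l S. label_prob f \<sigma> z i) \<le> 1"
    using measure_label_set[OF f assms(2), of "insert l S" z] assms(3)
    by (metis finite_insert prob_le_1)
  thus ?thesis using assms by simp
qed

text \<open>The exchange replaces each \<open>b j\<close> outside \<open>G\<close> by an element of \<open>G\<close> outside the range of \<open>b\<close>.\<close>

lemma top_labels_exchange:
  assumes b: "top_labels q c k l b" and G: "G \<subseteq> {1..c} - {l}" "card G = k" and t: "t \<le> k"
  obtains S where "S \<subseteq> G" "card S = t" "sum q S \<le> (\<Sum>j=1..t. q (b j))"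
proof -
  let ?B = "b ` {1..k}"
  have inj: "inj_on b {1..k}" and cB: "card ?B = k"
    using b by (auto simp: top_labels_def card_image)
  have fin: "finite G" "finite ?B" using G finite_subset by auto
  have "card (?B - G) = card (G - ?B)"
    using fin cB G by (metis card_Diff_subset_Int Int_commute finite_Int)
  then obtain h where h: "bij_betw h (?B - G) (G - ?B)"
    using fin by (meson finite_Diff finite_same_card_bij)
  define \<pi> where "\<pi> i = (if i \<in> G then i else h i)" for i
  have \<pi>_mem: "\<pi> i \<in> G" if "i \<in> ?B" for i
    using that h by (auto simp: \<pi>_def bij_betw_def)
  \<comment> \<open>A replacement lies outside the range of \<open>b\<close>, hence its value is at
    most that of every chosen label.\<close>
  have \<pi>_le: "q (\<pi> i) \<le> q i" if "i \<in> ?B" for i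
  proof (cases "i \<in> G")
    case False
    hence "h i \<in> G - ?B" using bij_betwE[OF h] that by blast
    hence "h i \<in> {1..c} - {l} - ?B" using G by blast
    thus ?thesis using that b False by (auto simp: \<pi>_def top_labels_def)
  qed (simp add: \<pi>_def)
  have \<pi>_inj: "inj_on \<pi> ?B"
  proof (rule inj_onI)
    fix i j assume ij: "i \<in> ?B" "j \<in> ?B" "\<pi> i = \<pi> j"
    \<comment> \<open>Replacements avoid the range of \<open>b\<close>, so they cannot collide with
      the labels that \<open>\<pi>\<close> leaves fixed.\<close>
    have out: "h i' \<notin> ?B" if "i' \<in> ?B" "i' \<notin> G" for i'
      using bij_betwE[OF h] that by blast
    show "i = j"
    proof (cases "i \<in> G"; cases "j \<in> G")
      assume "i \<notin> G" "j \<notin> G"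
      thus ?thesis using bij_betw_imp_inj_on[OF h] ij by (auto simp: \<pi>_def dest: inj_onD)
    next
      assume "i \<in> G" "j \<notin> G"
      thus ?thesis using out[of j] ij(1,2) ij(3) unfolding \<pi>_def by metis
    next
      assume "i \<notin> G" "j \<in> G"
      thus ?thesis using out[of i] ij(1,2) ij(3) unfolding \<pi>_def by metis
    qed (use ij(3) in \<open>simp add: \<pi>_def\<close>)
  qed
  have sub: "{1..t} \<subseteq> {1..k}" using t by auto
  have inj': "inj_on (\<lambda>j. \<pi> (b j)) {1..t}"
    using comp_inj_on[OF inj \<pi>_inj] sub by (auto simp: o_def intro: inj_on_subset)
  show ?thesis
  proof (rule that[of "(\<lambda>j. \<pi> (b j)) ` {1..t}"])
    show "(\<lambda>j. \<pi> (b j)) ` {1..t} \<subseteq> G" using \<pi>_mem sub by auto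
    show "card ((\<lambda>j. \<pi> (b j)) ` {1..t}) = t" using card_image[OF inj'] by simp
    show "sum q ((\<lambda>j. \<pi> (b j)) ` {1..t}) \<le> (\<Sum>j=1..t. q (b j))"
      unfolding sum.reindex[OF inj'] o_def using sub by (intro sum_mono \<pi>_le) auto
  qed
qed

text \<open>Count 0 gives exactly 0 by convention; every other count gives a quantile strictly
  inside the unit interval.\<close>

lemma lower_bound_range:
  assumes "N l \<le> n" "0 < \<alpha>" "\<alpha> < 1" "1 < c"
  shows "lower_bound m \<alpha> c n N l < 1"
    and "lower_bound m \<alpha> c n N l \<noteq> 0 \<Longrightarrow> 0 < lower_bound m \<alpha> c n N l"
proof -
  have "0 < \<alpha> / real c" "\<alpha> / real c < 1" using assms by (simp_all add: divide_less_eq)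
  hence "lower_bound m \<alpha> c n N l < 1 \<and> (lower_bound m \<alpha> c n N l \<noteq> 0 \<longrightarrow> 0 < lower_bound m \<alpha> c n N l)"
    using beta_quantile_bounds[of "N l" n] assms
    by (cases "N l = 0"; cases m) (auto simp: beta_quantile_def[of _ 0])
  thus "lower_bound m \<alpha> c n N l < 1"
    "lower_bound m \<alpha> c n N l \<noteq> 0 \<Longrightarrow> 0 < lower_bound m \<alpha> c n N l" by auto
qed

text \<open>Positivity of each summand makes \<open>sum_bound\<close> positive, so that
  \<open>inv std_normal_cdf\<close> is meaningful there.\<close>

lemma upper_bound_pos:
  assumes "N l \<le> n" "N i \<le> n" "0 < \<alpha>" "\<alpha> < 1" "1 < c"
  shows "0 < upper_bound m \<alpha> c n N l i"
proof (cases m)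
  case BINOCP
  thus ?thesis using lower_bound_range(1)[of N l n \<alpha> c BINOCP] assms by simp
next
  case SIMUEM
  have \<beta>: "0 < 1 - \<alpha> / real c" "1 - \<alpha> / real c < 1" using assms by (simp_all add: divide_less_eq)
  show ?thesis
  proof (cases "N i = n")
    case True
    thus ?thesis by (simp add: SIMUEM beta_quantile_def)
  next
    case False
    thus ?thesis
      using beta_quantile_bounds(1)[of "Suc (N i)" n, OF _ _ \<beta>] assms by (simp add: SIMUEM add_ac)
  qed
qed

text \<open>The deterministic half: \<open>e\<close> is one fixed sample on which all bounds used
  are valid.\<close>

lemma certify_sound:
  fixes f :: "real ^ 'd \<Rightarrow> nat" and x :: "real ^ 'd"
  assumes f: "f \<in> borel \<rightarrow>\<^sub>M count_space {1..c}"
    and k: "1 \<le> k" "k \<le> c - 1" and \<sigma>: "\<sigma> > 0" and l: "l \<in> {1..c}"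
    and \<alpha>: "0 < \<alpha>" "\<alpha> < 1"
    and g: "smoothed_classifier f c k \<sigma> g"
    and lower: "lower_bound m \<alpha> c n (label_count f x n e) l \<le> label_prob f \<sigma> x l"
    and upper: "\<And>i. i \<in> {1..c} - {l} \<Longrightarrow>
      label_prob f \<sigma> x i \<le> upper_bound m \<alpha> c n (label_count f x n e) l i"
    and cert: "certify f c k \<sigma> x l n \<mu> \<alpha> m e (Some r)"
    and \<delta>: "norm \<delta> < r"
  shows "l \<in> g (x + \<delta>)"
proof (rule ccontr)
  assume "l \<notin> g (x + \<delta>)"
  define p where "p = lower_bound m \<alpha> c n (label_count f x n e) l"
  define q where "q = upper_bound m \<alpha> c n (label_count f x n e) l"
  obtain b R where b: "top_labels q c k l b"
    and R: "\<forall>t\<in>{1..k}. if p = 0 then R t \<le> 0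
              else R t \<le> exact_radius \<sigma> t p (sum_bound p q b t) \<and>
                   exact_radius \<sigma> t p (sum_bound p q b t) \<le> R t + \<mu>"
    and r: "Some r = (if max 0 (Max (R ` {1..k})) > 0 then Some (max 0 (Max (R ` {1..k}))) else None)"
    using cert unfolding certify_def Let_def p_def[symmetric] q_def[symmetric] by blast
  have "r = max 0 (Max (R ` {1..k}))" "r > 0" using r by (auto split: if_splits)
  hence "r = Max (R ` {1..k})" by (auto simp: max_def split: if_splits)
  \<comment> \<open>The maximum is attained, so a single \<open>t\<close> accounts for the returned
    radius; the contradiction is derived at this \<open>t\<close>. Since \<open>R t > 0\<close>, the
    case \<open>p = 0\<close> is excluded.\<close>
  moreover have "Max (R ` {1..k}) \<in> R ` {1..k}" using k by (intro Max_in) auto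
  ultimately obtain t where t: "t \<in> {1..k}" "r = R t" by auto
  have "p \<noteq> 0" using bspec[OF R t(1)] t(2) \<open>r > 0\<close> by auto
  have c: "1 < c" using k by simp
  have p: "0 < p" "p < 1"
    using lower_bound_range[of "label_count f x n e" l n \<alpha> c m] label_count_le[of f x n e l] \<alpha> c \<open>p \<noteq> 0\<close>
    by (auto simp: p_def)
  define s where "s = sum_bound p q b t"
  have "0 < (\<Sum>j=1..t. q (b j))"
    unfolding q_def using t label_count_le \<alpha> c by (intro sum_pos upper_bound_pos) auto
  \<comment> \<open>Both arguments of the minimum are positive, the cap because
    \<open>p < 1\<close>; the cap is below 1 because \<open>p > 0\<close>.\<close>
  hence s: "0 < s" "s < 1" using p by (auto simp: s_def sum_bound_def)
  have "r \<le> exact_radius \<sigma> t p s" using R t \<open>p \<noteq> 0\<close> by (auto simp: s_def)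
  hence pos: "std_normal_cdf (inv std_normal_cdf p - norm \<delta> / \<sigma>)
      - 1 / real t * std_normal_cdf (inv std_normal_cdf s + norm \<delta> / \<sigma>) > 0"
    using \<sigma> p s t \<delta> by (intro radius_equation_pos) auto

  have G: "g (x + \<delta>) \<subseteq> {1..c} - {l}" "card (g (x + \<delta>)) = k"
    using g \<open>l \<notin> g (x + \<delta>)\<close> by (auto simp: smoothed_classifier_def)
  obtain S where S: "S \<subseteq> g (x + \<delta>)" "card S = t" "sum q S \<le> (\<Sum>j=1..t. q (b j))"
    using top_labels_exchange[OF b G, of t] t by auto
  have finS: "finite S" using S(1) G(1) by (meson finite_Diff finite_atLeastAtMost finite_subset)
  have "(\<Sum>i\<in>S. label_prob f \<sigma> x i) \<le> sum q S"
    unfolding q_def using S(1) G(1) by (intro sum_mono upper) auto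
  moreover have "l \<notin> S" using S(1) \<open>l \<notin> g (x + \<delta>)\<close> by auto
  hence "(\<Sum>i\<in>S. label_prob f \<sigma> x i) \<le> 1 - p"
    using sum_label_prob_le[OF f \<sigma> finS, of l x] lower by (simp add: p_def)
  ultimately have "measure (isotropic_gaussian \<sigma>) {e. f (x + e) \<in> S} \<le> s"
    using S(3) by (simp add: measure_label_set[OF f \<sigma> finS] s_def sum_bound_def)
  from isotropic_gaussian_shift_upper[OF \<sigma> label_set_measurable[OF f] s this, of \<delta>]
  have up: "(\<Sum>i\<in>S. label_prob f \<sigma> (x + \<delta>) i) \<le> std_normal_cdf (inv std_normal_cdf s + norm \<delta> / \<sigma>)"
    by (simp add: measure_label_set[OF f \<sigma> finS, symmetric] add.assoc)

  have "p \<le> measure (isotropic_gaussian \<sigma>) {e. f (x + e) \<in> {l}}"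
    using lower by (simp add: p_def label_prob_def)
  from isotropic_gaussian_shift_lower[OF \<sigma> label_set_measurable[OF f] p this, of \<delta>]
  have low: "std_normal_cdf (inv std_normal_cdf p - norm \<delta> / \<sigma>) \<le> label_prob f \<sigma> (x + \<delta>) l"
    by (simp add: label_prob_def add.assoc)

  have "label_prob f \<sigma> (x + \<delta>) l \<le> label_prob f \<sigma> (x + \<delta>) i" if "i \<in> S" for i
    using that S(1) g l \<open>l \<notin> g (x + \<delta>)\<close> by (auto simp: smoothed_classifier_def)
  hence "real (card S) * label_prob f \<sigma> (x + \<delta>) l \<le> (\<Sum>i\<in>S. label_prob f \<sigma> (x + \<delta>) i)"
    by (intro sum_bounded_below) auto
  \<comment> \<open>After multiplication by \<open>t\<close>, \<open>pos\<close> is the strict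
    reverse of this inequality.\<close>
  with low up have "real t * std_normal_cdf (inv std_normal_cdf p - norm \<delta> / \<sigma>) \<le>
      std_normal_cdf (inv std_normal_cdf s + norm \<delta> / \<sigma>)"
    using mult_left_mono[OF low, of "real t"] S(2) by simp
  thus False using pos t by (simp add: field_simps)
qed

section \<open>The probability that some confidence bound fails\<close>

theorem proposition2:
  fixes f :: "real ^ 'd \<Rightarrow> nat"
    and g :: "real ^ 'd \<Rightarrow> nat set"
    and c k l n :: nat
    and \<sigma> \<mu> \<alpha> :: real
    and x :: "real ^ 'd"
    and m :: bound_method
    and M :: "'w measure"
    and \<epsilon> :: "nat \<Rightarrow> 'w \<Rightarrow> real ^ 'd"
  assumes "f \<in> borel \<rightarrow>\<^sub>M count_space {1..c}"
    and "1 \<le> k" and "k \<le> c - 1"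
    and "\<sigma> > 0"
    and "l \<in> {1..c}"
    and "n \<ge> 1"
    and "\<mu> > 0"
    and "0 < \<alpha>" and "\<alpha> < 1"
    and "smoothed_classifier f c k \<sigma> g"
    and "prob_space M"
    and "prob_space.indep_vars M (\<lambda>_. borel) \<epsilon> {1..n}"
    and "\<forall>j\<in>{1..n}. distr M borel (\<epsilon> j) = isotropic_gaussian \<sigma>"
  shows "measure M {\<omega> \<in> space M.
           \<forall>r. certify f c k \<sigma> x l n \<mu> \<alpha> m (\<lambda>j. \<epsilon> j \<omega>) (Some r) \<longrightarrow>
               (\<forall>\<delta>. norm \<delta> < r \<longrightarrow> l \<in> g (x + \<delta>))} \<ge> 1 - \<alpha>"
proof -
  note f = assms(1) and k = assms(2,3) and \<sigma> = assms(4) and l = assms(5) and \<alpha> = assms(8,9)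
  interpret prob_space M by fact
  define Y where "Y j \<omega> = f (x + \<epsilon> j \<omega>)" for j \<omega>
  interpret Y: iid_labels M "{1..n}" "{1..c}" Y "label_prob f \<sigma> x"
  proof
    have fx: "(\<lambda>e. f (x + e)) \<in> borel \<rightarrow>\<^sub>M count_space {1..c}"
      by (rule measurable_compose[OF _ f]) simp
    show "indep_vars (\<lambda>_. count_space {1..c}) Y {1..n}"
      unfolding Y_def by (rule indep_vars_compose2[OF assms(12) fx])
    show "prob (Y i -` {a} \<inter> space M) = label_prob f \<sigma> x a" if "i \<in> {1..n}" for i a
    proof -
      have \<epsilon>: "\<epsilon> i \<in> borel_measurable M" using assms(12) that by (simp add: indep_vars_def)
      have "label_prob f \<sigma> x a = measure (distr M borel (\<epsilon> i)) {e. f (x + e) \<in> {a}}"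
        using assms(13) that by (simp add: label_prob_def)
      also have "\<dots> = prob (\<epsilon> i -` {e. f (x + e) \<in> {a}} \<inter> space M)"
        by (rule measure_distr[OF \<epsilon>]) (rule label_set_measurable[OF f])
      also have "\<epsilon> i -` {e. f (x + e) \<in> {a}} \<inter> space M = Y i -` {a} \<inter> space M"
        by (auto simp: Y_def)
      finally show ?thesis ..
    qed
  qed (simp_all add: label_prob_bounds[OF \<sigma>])
  have N: "label_count f x n (\<lambda>j. \<epsilon> j \<omega>) = occurrences Y {1..n} \<omega>" for \<omega>
    by (simp add: fun_eq_iff label_count_def occurrences_def Y_def)
  let ?N = "occurrences Y {1..n}"
  let ?P = "label_prob f \<sigma> x"
  let ?goal = "{\<omega> \<in> space M.
           \<forall>r. certify f c k \<sigma> x l n \<mu> \<alpha> m (\<lambda>j. \<epsilon> j \<omega>) (Some r) \<longrightarrow>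
               (\<forall>\<delta>. norm \<delta> < r \<longrightarrow> l \<in> g (x + \<delta>))}"
  \<comment> \<open>The algorithm sees the samples only through the counts, so the event is a
    predicate of \<open>?N \<omega>\<close>.\<close>
  have goal: "?goal \<in> events"
    unfolding certify_def N by (rule Y.events_counts)
  \<comment> \<open>The \<open>SIMUEM\<close> formula for \<open>i \<noteq> l\<close> is written for
    either method: under \<open>BINOCP\<close> the set \<open>L\<close> is \<open>{l}\<close>, and
    only \<open>bad l\<close> enters the union.\<close>
  define bad where "bad i = (if i = l
      then {\<omega> \<in> space M. ?P l < lower_bound m \<alpha> c n (?N \<omega>) l}
      else {\<omega> \<in> space M. upper_bound SIMUEM \<alpha> c n (?N \<omega>) l i < ?P i})" for i
  define L where "L = (case m of BINOCP \<Rightarrow> {l} | SIMUEM \<Rightarrow> {1..c})"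
  have L: "finite L" "L \<subseteq> {1..c}" "l \<in> L" using l by (auto simp: L_def split: bound_method.splits)
  have bad: "bad i \<in> events" for i
  proof (cases "i = l")
    case True
    show ?thesis
      using Y.events_counts[where Q = "\<lambda>N. ?P l < lower_bound m \<alpha> c n N l"]
      unfolding bad_def if_P[OF True] .
  next
    case False
    show ?thesis
      using Y.events_counts[where Q = "\<lambda>N. upper_bound SIMUEM \<alpha> c n N l i < ?P i"]
      unfolding bad_def if_not_P[OF False] .
  qed
  have \<alpha>c: "0 < \<alpha> / real c" "\<alpha> / real c < 1" using \<alpha> l by (auto simp: divide_less_eq)
  have "prob (\<Union>i\<in>L. bad i) \<le> (\<Sum>i\<in>L. prob (bad i))"
    by (rule measure_UNION_le) (use L bad in auto)
  also have "\<dots> \<le> \<alpha>"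
  proof (cases m)
    case BINOCP
    thus ?thesis using Y.clopper_pearson_lower[OF l \<alpha>] by (simp add: L_def bad_def)
  next
    case SIMUEM
    have "prob (bad i) \<le> \<alpha> / real c" if "i \<in> {1..c}" for i
      using Y.clopper_pearson_lower[OF l \<alpha>c] Y.clopper_pearson_upper[OF that \<alpha>c]
      by (simp add: bad_def SIMUEM)
    hence "(\<Sum>i\<in>{1..c}. prob (bad i)) \<le> real (card {1..c}) * (\<alpha> / real c)"
      by (rule sum_bounded_above)
    thus ?thesis using l by (simp add: L_def SIMUEM)
  qed
  finally have "1 - \<alpha> \<le> prob (space M - (\<Union>i\<in>L. bad i))"
    using L bad by (subst prob_compl) auto
  also have "\<dots> \<le> prob ?goal"
  proof (rule finite_measure_mono[OF _ goal], rule subsetI)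
    fix \<omega> assume "\<omega> \<in> space M - (\<Union>i\<in>L. bad i)"
    hence \<omega>: "\<omega> \<in> space M" and good: "\<omega> \<notin> bad i" if "i \<in> L" for i using that by auto
    have lower: "lower_bound m \<alpha> c n (?N \<omega>) l \<le> ?P l"
      using good[of l] \<omega> L by (auto simp: bad_def)
    have upper: "?P i \<le> upper_bound m \<alpha> c n (?N \<omega>) l i" if i: "i \<in> {1..c} - {l}" for i
    proof (cases m)
      case BINOCP
      \<comment> \<open>The upper bounds of \<open>BINOCP\<close> follow from its lower bound, so a
        single event at the full level \<open>\<alpha>\<close> suffices.\<close>
      have "?P i \<le> 1 - ?P l" using sum_label_prob_le[OF f \<sigma>, of "{i}" l x] i by simp
      thus ?thesis using lower by (simp add: BINOCP)
    next
      case SIMUEM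
      thus ?thesis using good[of i] \<omega> i L by (auto simp: bad_def L_def)
    qed
    show "\<omega> \<in> ?goal"
      using \<omega> L certify_sound[OF f k \<sigma> l \<alpha> assms(10), of m n x "\<lambda>j. \<epsilon> j \<omega>"] lower upper
      unfolding N by blast
  qed
  finally show ?thesis .
qed

end
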